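(* Let $X$ be a centered random vector in $\mathbb{R}^d$ with a density and with invertible covariance matrix $C$, admitting a Stein matrix $\tau_X(X)$. Let $Z$ be a centered Gaussian random vector with covariance $C$, independent of $X$, and let $X_t=\sqrt{t}\,X+\sqrt{1-t}\,Z$. Then for all $0<t<1$, $$J(X_t)=\frac{t^2}{1-t}\,E\left[E\left[(Id-C^{-1}\tau_X(X))C^{-1}Z\,|\,X_t\right]\,E\left[(Id-C^{-1}\tau_X(X))C^{-1}Z\,|\,X_t\right]^T\right]+C^{-1}$$ and $$J_{st}(X_t)=\frac{t^2}{1-t}\,\mathrm{tr}\left(C\,E\left[E\left[(Id-C^{-1}\tau_X(X))C^{-1}Z\,|\,X_t\right]\,E\left[(Id-C^{-1}\tau_X(X))C^{-1}Z\,|\,X_t\right]^T\right]\right).$$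
   Context: Vectors in $\mathbb{R}^d$ are $d\times 1$ columns, $Id$ is the $d\times d$ identity matrix, $\cdot^T$ is the transpose, $\mathrm{tr}$ the trace. The score of a random vector $X$ is the random vector $\rho_X(X)$ (a measurable function of $X$) satisfying $E[\rho_X(X)\varphi(X)]=-E[\nabla\varphi(X)]$ for all real-valued $\varphi\in C_c^\infty(\mathbb{R}^d)$. A Stein matrix of $X$ is any random $d\times d$ matrix $\tau_X(X)$ (a measurable function of $X$) satisfying $E[\tau_X(X)\nabla\varphi(X)]=E[X\varphi(X)]$ for all real-valued $\varphi\in C_c^\infty(\mathbb{R}^d)$. For a random vector $V$ with invertible covariance $B$ and score $\rho_V(V)$: the Fisher information matrix is $J(V)=E[\rho_V(V)\rho_V(V)^T]$, the relative Fisher information matrix is $\mathcal{J}(V)=E[(\rho_V(V)+B^{-1}V)(\rho_V(V)+B^{-1}V)^T]$, and the standardised Fisher information distance is $J_{st}(V)=\mathrm{tr}(B\,\mathcal{J}(V))$. *)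

theory Defs
  imports "HOL-Probability.Probability"
begin

definition gradient :: "(real^'n \<Rightarrow> real) \<Rightarrow> real^'n \<Rightarrow> real^'n" where
  "gradient \<phi> x = (\<chi> i. frechet_derivative \<phi> (at x) (axis i 1))"

text \<open>\<open>Ck k \<phi>\<close>: \<open>\<phi>\<close> is of class \<open>C\<^sup>k\<close> on the whole space, by recursion on its partial derivatives.\<close>

primrec Ck :: "nat \<Rightarrow> (real^'n \<Rightarrow> real) \<Rightarrow> bool" where
  "Ck 0 \<phi> \<longleftrightarrow> continuous_on UNIV \<phi>"
| "Ck (Suc k) \<phi> \<longleftrightarrow>
     (\<forall>x. \<phi> differentiable (at x)) \<and> (\<forall>i. Ck k (\<lambda>x. gradient \<phi> x $ i))"

definition test_function :: "(real^'n \<Rightarrow> real) \<Rightarrow> bool" where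
  "test_function \<phi> \<longleftrightarrow> (\<forall>k. Ck k \<phi>) \<and> compact (closure {x. \<phi> x \<noteq> 0})"

definition outer :: "real^'n \<Rightarrow> real^'n \<Rightarrow> real^'n^'n" where
  "outer u v = (\<chi> i j. u $ i * v $ j)"

definition covariance_matrix :: "'a measure \<Rightarrow> ('a \<Rightarrow> real^'n) \<Rightarrow> real^'n^'n" where
  "covariance_matrix M X =
     (LINT \<omega>|M. outer (X \<omega> - integral\<^sup>L M X) (X \<omega> - integral\<^sup>L M X))"

text \<open>Since the Bochner integral of a non-integrable function is \<open>0\<close>, the integrability that the
  identities defining scores and Stein matrices presuppose is required explicitly.\<close>

definition is_score :: "'a measure \<Rightarrow> ('a \<Rightarrow> real^'n) \<Rightarrow> (real^'n \<Rightarrow> real^'n) \<Rightarrow> bool" where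
  "is_score M X \<rho> \<longleftrightarrow>
     \<rho> \<in> borel_measurable borel \<and>
     (\<forall>\<phi>. test_function \<phi> \<longrightarrow>
        integrable M (\<lambda>\<omega>. \<phi> (X \<omega>) *\<^sub>R \<rho> (X \<omega>)) \<and>
        (LINT \<omega>|M. \<phi> (X \<omega>) *\<^sub>R \<rho> (X \<omega>)) = - (LINT \<omega>|M. gradient \<phi> (X \<omega>)))"

definition is_stein_matrix ::
    "'a measure \<Rightarrow> ('a \<Rightarrow> real^'n) \<Rightarrow> (real^'n \<Rightarrow> real^'n^'n) \<Rightarrow> bool" where
  "is_stein_matrix M X \<tau> \<longleftrightarrow>
     \<tau> \<in> borel_measurable borel \<and>
     (\<forall>\<phi>. test_function \<phi> \<longrightarrow>
        integrable M (\<lambda>\<omega>. \<tau> (X \<omega>) *v gradient \<phi> (X \<omega>)) \<and>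
        (LINT \<omega>|M. \<tau> (X \<omega>) *v gradient \<phi> (X \<omega>)) = (LINT \<omega>|M. \<phi> (X \<omega>) *\<^sub>R X \<omega>))"

text \<open>A score is determined only up to almost sure equality of \<open>\<rho> (V \<omega>)\<close>, so it is an argument of
  the following quantities; their values do not depend on the version.\<close>

definition fisher_information ::
    "'a measure \<Rightarrow> ('a \<Rightarrow> real^'n) \<Rightarrow> (real^'n \<Rightarrow> real^'n) \<Rightarrow> real^'n^'n" where
  "fisher_information M V \<rho> = (LINT \<omega>|M. outer (\<rho> (V \<omega>)) (\<rho> (V \<omega>)))"

definition relative_fisher_information ::
    "'a measure \<Rightarrow> ('a \<Rightarrow> real^'n) \<Rightarrow> (real^'n \<Rightarrow> real^'n) \<Rightarrow> real^'n^'n" where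
  "relative_fisher_information M V \<rho> =
     (LINT \<omega>|M. outer (\<rho> (V \<omega>) + matrix_inv (covariance_matrix M V) *v V \<omega>)
                     (\<rho> (V \<omega>) + matrix_inv (covariance_matrix M V) *v V \<omega>))"

definition standardised_fisher_distance ::
    "'a measure \<Rightarrow> ('a \<Rightarrow> real^'n) \<Rightarrow> (real^'n \<Rightarrow> real^'n) \<Rightarrow> real" where
  "standardised_fisher_distance M V \<rho> =
     trace (covariance_matrix M V ** relative_fisher_information M V \<rho>)"

text \<open>Density of the centered Gaussian law with invertible covariance matrix \<open>C\<close>.\<close>

definition gaussian_density :: "real^'n^'n \<Rightarrow> real^'n \<Rightarrow> real" where
  "gaussian_density C z =
     exp (- (z \<bullet> (matrix_inv C *v z)) / 2) / sqrt ((2 * pi) ^ CARD('n) * det C)"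

definition centered_gaussian :: "'a measure \<Rightarrow> real^'n^'n \<Rightarrow> ('a \<Rightarrow> real^'n) \<Rightarrow> bool" where
  "centered_gaussian M C Z \<longleftrightarrow> distributed M lborel Z (\<lambda>z. ennreal (gaussian_density C z))"

text \<open>Componentwise conditional expectation of \<open>Y\<close> given the sigma-algebra generated by \<open>V\<close>.\<close>

definition cond_exp_vec ::
    "'a measure \<Rightarrow> ('a \<Rightarrow> real^'n) \<Rightarrow> ('a \<Rightarrow> real^'n) \<Rightarrow> 'a \<Rightarrow> real^'n" where
  "cond_exp_vec M V Y \<omega> =
     (\<chi> i. real_cond_exp M (vimage_algebra (space M) V borel) (\<lambda>\<omega>'. Y \<omega>' $ i) \<omega>)"

end

theory Submission
  imports Defs
begin

text \<open>Write \<open>G = C\<^sup>-\<^sup>1\<close>. Gaussian integration by parts in \<open>Z\<close> gives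
  \<open>E[\<phi>(X\<^sub>t) G Z] = sqrt (1 - t) E[\<nabla>\<phi>(X\<^sub>t)]\<close> for every test function \<open>\<phi>\<close>, so
  \<open>- E[G Z | X\<^sub>t] / sqrt (1 - t)\<close> is a score; Jensen's inequality makes it square integrable, and its
  correlation with \<open>X\<^sub>t\<close> is \<open>-Id\<close>. Combining the same integration by parts with the Stein
  identity for \<open>X\<close> shows that \<open>- t / sqrt (1 - t) E[(Id - G \<tau>(X)) G Z | X\<^sub>t] - G X\<^sub>t\<close> is a score as
  well. Scores are almost surely unique because test functions approximate indicators of boxes, so
  both expressions agree, and expanding the square gives both formulas.\<close>

subsection \<open>Test functions\<close>

text \<open>Neither representation of the score suffices alone. \<open>G Z\<close> is square
  integrable, so Jensen applies to the first. The coefficients are forced: the second representation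
  tested against \<phi> yields t E[\<nabla>\<phi>(Xt)] from W and (1 - t) E[\<nabla>\<phi>(Xt)] from
  G Xt, while the terms in E[\<phi>(Xt) X] cancel. The obstacle is integrability. A Stein matrix is
  controlled only against gradients of compactly supported functions of X, whereas in \<tau>(X)
  \<nabla>\<phi>(Xt) the cut-off acts on Xt and leaves X unbounded. Hence \<tau>(X) itself must be
  shown integrable before Fubini can be applied.\<close>

lemma gradient_eqI:
  fixes \<phi> :: "real^'n \<Rightarrow> real"
  assumes "(\<phi> has_derivative D) (at x)"
  shows "gradient \<phi> x = (\<chi> i. D (axis i 1))"
  using frechet_derivative_at[OF assms] by (simp add: gradient_def)

lemma differentiable_has_derivative:
  "\<phi> differentiable F \<Longrightarrow> (\<phi> has_derivative frechet_derivative \<phi> F) F"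
  by (simp add: frechet_derivative_works)

text \<open>Products need this: after one application of the product rule the undifferentiated
  factors reappear and are wanted at the lower order.\<close>

lemma Ck_Suc_lower: "Ck (Suc k) \<phi> \<Longrightarrow> Ck k \<phi>"
proof (induction k arbitrary: \<phi>)
  case 0
  then show ?case
    by (auto intro!: continuous_at_imp_continuous_on differentiable_imp_continuous_within)
next
  case (Suc k)
  then show ?case by auto
qed

lemma Ck_add:
  assumes "Ck k \<phi>" "Ck k \<psi>"
  shows "Ck k (\<lambda>x. \<phi> x + \<psi> x)"
  using assms
proof (induction k arbitrary: \<phi> \<psi>)
  case 0
  then show ?case by (auto intro: continuous_intros)
next
  case (Suc k)
  have "gradient (\<lambda>x. \<phi> x + \<psi> x) x = gradient \<phi> x + gradient \<psi> x" for x
    using Suc.prems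
    by (subst gradient_eqI[OF has_derivative_add[OF differentiable_has_derivative differentiable_has_derivative]])
       (auto simp: gradient_def vec_eq_iff)
  with Suc show ?case by (auto intro: differentiable_add)
qed

lemma Ck_mult:
  assumes "Ck k \<phi>" "Ck k \<psi>"
  shows "Ck k (\<lambda>x. \<phi> x * \<psi> x)"
  using assms
proof (induction k arbitrary: \<phi> \<psi>)
  case 0
  then show ?case by (auto intro: continuous_intros)
next
  case (Suc k)
  have grad: "gradient (\<lambda>x. \<phi> x * \<psi> x) x $ i = \<phi> x * gradient \<psi> x $ i + gradient \<phi> x $ i * \<psi> x" for x i
    using Suc.prems
    by (subst gradient_eqI[OF has_derivative_mult[OF differentiable_has_derivative differentiable_has_derivative]])
       (auto simp: gradient_def)
  show ?case
    using Suc.prems Suc.prems[THEN Ck_Suc_lower]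
    by (auto simp: grad intro!: differentiable_mult Ck_add Suc.IH)
qed

lemma Ck_prod:
  assumes "finite I" "\<And>i. i \<in> I \<Longrightarrow> Ck k (\<phi> i)"
  shows "Ck k (\<lambda>x. \<Prod>i\<in>I. \<phi> i x)"
proof -
  have const: "Ck k (\<lambda>x::real^'n. c)" for c :: real
  proof (induction k arbitrary: c)
    case (Suc k)
    have "gradient (\<lambda>x::real^'n. c) x $ i = 0" for x i
      by (subst gradient_eqI[OF has_derivative_const]) simp
    with Suc show ?case by simp
  qed simp
  show ?thesis
    using assms by (induction I rule: finite_induct) (auto intro: const Ck_mult)
qed

lemma gradient_affine:
  fixes \<phi> :: "real^'n \<Rightarrow> real"
  assumes "\<phi> differentiable (at (a *\<^sub>R x + b))"
  shows "((\<lambda>x. \<phi> (a *\<^sub>R x + b)) has_derivative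
           (\<lambda>h. a * frechet_derivative \<phi> (at (a *\<^sub>R x + b)) h)) (at x)"
    and "gradient (\<lambda>x. \<phi> (a *\<^sub>R x + b)) x = a *\<^sub>R gradient \<phi> (a *\<^sub>R x + b)"
proof -
  have "linear (frechet_derivative \<phi> (at (a *\<^sub>R x + b)))"
    using linear_frechet_derivative[OF assms] .
  then have lin: "frechet_derivative \<phi> (at (a *\<^sub>R x + b)) (a *\<^sub>R h)
       = a * frechet_derivative \<phi> (at (a *\<^sub>R x + b)) h" for h
    by (simp add: linear_cmul)
  have "((\<lambda>x. a *\<^sub>R x + b) has_derivative (\<lambda>h. a *\<^sub>R h)) (at x)"
    by (auto intro!: derivative_eq_intros)
  from has_derivative_compose[OF this differentiable_has_derivative[OF assms]]
  show *: "((\<lambda>x. \<phi> (a *\<^sub>R x + b)) has_derivative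
           (\<lambda>h. a * frechet_derivative \<phi> (at (a *\<^sub>R x + b)) h)) (at x)"
    by (simp add: lin)
  show "gradient (\<lambda>x. \<phi> (a *\<^sub>R x + b)) x = a *\<^sub>R gradient \<phi> (a *\<^sub>R x + b)"
    unfolding gradient_eqI[OF *] by (simp add: gradient_def vec_eq_iff)
qed

text \<open>The scalar \<open>c\<close> closes the induction: differentiating produces another
  factor \<open>a\<close>, which is absorbed by passing from \<open>c\<close> to
  \<open>c * a\<close>.\<close>

lemma Ck_affine:
  fixes \<phi> :: "real^'n \<Rightarrow> real"
  assumes "Ck k \<phi>"
  shows "Ck k (\<lambda>x. c * \<phi> (a *\<^sub>R x + b))"
  using assms
proof (induction k arbitrary: \<phi> c)
  case 0
  then have "continuous_on UNIV (\<lambda>x. \<phi> (a *\<^sub>R x + b))"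
    by (auto intro!: continuous_on_compose2[of UNIV \<phi>] continuous_intros)
  then show ?case by (auto intro: continuous_intros)
next
  case (Suc k)
  have D: "((\<lambda>x. c * \<phi> (a *\<^sub>R x + b)) has_derivative
           (\<lambda>h. c * (a * frechet_derivative \<phi> (at (a *\<^sub>R x + b)) h))) (at x)" for x
    using Suc.prems by (intro has_derivative_mult_right gradient_affine(1)) auto
  have "gradient (\<lambda>x. c * \<phi> (a *\<^sub>R x + b)) x $ i = (c * a) * gradient \<phi> (a *\<^sub>R x + b) $ i" for x i
    unfolding gradient_eqI[OF D] by (simp add: gradient_def)
  moreover have "(\<lambda>x. c * \<phi> (a *\<^sub>R x + b)) differentiable (at x)" for x
    using D[of x] by (auto simp: differentiable_def)
  ultimately show ?case
    using Suc.prems by (auto intro: Suc.IH)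
qed

text \<open>The new support lies in the image of the old one under the inverse affine map, which
  exists because \<open>a\<close> is nonzero. Freezing one variable of sqrt t x + sqrt (1 - t) z
  thus leaves a test function of the other.\<close>

lemma test_function_affine:
  fixes \<phi> :: "real^'n \<Rightarrow> real"
  assumes "test_function \<phi>" "a \<noteq> 0"
  shows "test_function (\<lambda>x. \<phi> (a *\<^sub>R x + b))"
proof -
  let ?S = "closure {x. \<phi> x \<noteq> 0}" and ?f = "\<lambda>y. (1 / a) *\<^sub>R (y - b)"
  have "compact ?S" using assms by (simp add: test_function_def)
  then have c: "compact (?f ` ?S)"
    by (intro compact_continuous_image continuous_intros)
  have "{x. \<phi> (a *\<^sub>R x + b) \<noteq> 0} \<subseteq> ?f ` ?S"
  proof
    fix x assume "x \<in> {x. \<phi> (a *\<^sub>R x + b) \<noteq> 0}"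
    then have "a *\<^sub>R x + b \<in> ?S" by (intro subsetD[OF closure_subset]) simp
    moreover have "x = ?f (a *\<^sub>R x + b)" using assms by simp
    ultimately show "x \<in> ?f ` ?S" by blast
  qed
  then have "closure {x. \<phi> (a *\<^sub>R x + b) \<noteq> 0} \<subseteq> ?f ` ?S"
    using c compact_imp_closed closure_minimal by blast
  then have "compact (closure {x. \<phi> (a *\<^sub>R x + b) \<noteq> 0})"
    using c by (metis bounded_subset closed_closure compact_eq_bounded_closed)
  then show ?thesis
    using assms Ck_affine[of _ \<phi> 1 a b] by (simp add: test_function_def)
qed

lemma test_function_mult:
  assumes "test_function \<phi>" "test_function \<psi>"
  shows "test_function (\<lambda>x. \<phi> x * \<psi> x)"
proof -
  have "{x. \<phi> x * \<psi> x \<noteq> 0} \<subseteq> {x. \<phi> x \<noteq> 0}" by auto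
  then have "closure {x. \<phi> x * \<psi> x \<noteq> 0} \<subseteq> closure {x. \<phi> x \<noteq> 0}" by (rule closure_mono)
  then have "compact (closure {x. \<phi> x * \<psi> x \<noteq> 0})"
    using assms unfolding test_function_def
    by (meson bounded_subset closed_closure compact_eq_bounded_closed)
  with assms show ?thesis by (auto simp: test_function_def intro: Ck_mult)
qed

lemma test_function_continuous:
  assumes "test_function \<phi>"
  shows "continuous_on UNIV \<phi>" "\<phi> differentiable (at x)" "continuous_on UNIV (\<lambda>x. gradient \<phi> x $ i)"
    "continuous_on UNIV (gradient \<phi>)"
proof -
  have *: "Ck 0 \<phi>" "Ck (Suc 0) \<phi>" using assms by (auto simp: test_function_def simp del: Ck.simps)
  then show "continuous_on UNIV \<phi>" "\<phi> differentiable (at x)" "continuous_on UNIV (\<lambda>x. gradient \<phi> x $ i)"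
    by auto
  show "continuous_on UNIV (gradient \<phi>)"
    using * continuous_on_vec_lambda[of UNIV "\<lambda>i x. gradient \<phi> x $ i"] by simp
qed

lemma test_function_bounded:
  assumes "test_function \<phi>"
  obtains A where "A > 0" "\<And>x. \<bar>\<phi> x\<bar> \<le> A" "\<And>x. norm (gradient \<phi> x) \<le> A"
proof -
  let ?S = "closure {x. \<phi> x \<noteq> 0}"
  have S: "compact ?S" using assms by (simp add: test_function_def)
  have "bounded (\<phi> ` ?S)" "bounded (gradient \<phi> ` ?S)"
    using test_function_continuous(1,4)[OF assms]
    by (auto intro!: compact_imp_bounded compact_continuous_image S intro: continuous_on_subset)
  then obtain A B where A: "A > 0" "\<forall>x\<in>?S. \<bar>\<phi> x\<bar> \<le> A" and B: "B > 0" "\<forall>x\<in>?S. norm (gradient \<phi> x) \<le> B"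
    by (auto simp: bounded_pos)
  have zero: "\<phi> x = 0" if "x \<notin> ?S" for x
    using that subsetD[OF closure_subset, of x "{x. \<phi> x \<noteq> 0}"] by auto
  have "gradient \<phi> x = 0" if "x \<notin> ?S" for x
  proof -
    \<comment> \<open>The complement of the closed support is open and \<phi> agrees there with the
      zero function, so the derivatives agree too.\<close>
    have "(\<phi> has_derivative (\<lambda>_. 0)) (at x)"
    proof (rule has_derivative_transform_within_open[OF has_derivative_const])
      show "open (- ?S)" by (simp only: open_Compl closed_closure)
      show "x \<in> - ?S" using that by (simp only: Compl_iff not_False_eq_True)
      show "0 = \<phi> y" if "y \<in> - ?S" for y
        using zero[of y] that by (simp only: Compl_iff not_False_eq_True)
    qed
    then show ?thesis by (simp add: gradient_eqI vec_eq_iff)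
  qed
  then have "\<bar>\<phi> x\<bar> \<le> A + B \<and> norm (gradient \<phi> x) \<le> A + B" for x
    using A B zero[of x] by (cases "x \<in> ?S") force+
  with that[of "A + B"] A(1) B(1) show ?thesis by simp
qed

text \<open>This family of flat functions is closed under differentiation, so all its members are smooth.\<close>

definition flat_exp :: "real poly \<Rightarrow> real \<Rightarrow> real" where
  "flat_exp p y = (if y > 0 then poly p (1 / y) * exp (- (1 / y)) else 0)"

text \<open>As \<open>flat_exp p 0 = 0\<close>, this is the difference quotient at the origin, the
  one point where differentiability is not evident. With x = 1 / y the limit from the right is that
  of x p(x) exp(-x) at infinity; the division by \<open>y\<close> turns \<open>p\<close> into
  \<open>pCons 0 p\<close>.\<close>

lemma flat_exp_quotient_tendsto_0:
  "((\<lambda>y. flat_exp p y / y) \<longlongrightarrow> 0) (at 0)"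
proof -
  have lim: "((\<lambda>x. poly q x * exp (- x)) \<longlongrightarrow> (0::real)) at_top" for q :: "real poly"
  proof -
    have "((\<lambda>x. \<Sum>i\<le>degree q. coeff q i * (x ^ i / exp x)) \<longlongrightarrow> (\<Sum>i\<le>degree q. coeff q i * 0)) at_top"
      by (intro tendsto_intros tendsto_power_div_exp_0)
    then show ?thesis
      by (simp add: poly_altdef sum_distrib_right exp_minus divide_inverse mult.assoc)
  qed
  have "filterlim (\<lambda>y::real. 1 / y) at_top (at_right 0)"
    using filterlim_inverse_at_top_right by (simp add: inverse_eq_divide)
  from filterlim_compose[OF lim[of "pCons 0 p"] this]
  have "((\<lambda>y. flat_exp p y / y) \<longlongrightarrow> 0) (at_right 0)"
    by (rule Lim_transform_eventually)
       (auto simp: flat_exp_def eventually_at_filter)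
  moreover have "((\<lambda>y. flat_exp p y / y) \<longlongrightarrow> 0) (at_left 0)"
    by (rule Lim_transform_eventually[OF tendsto_const])
       (auto simp: flat_exp_def eventually_at_filter)
  ultimately show ?thesis
    using filterlim_split_at by blast
qed

text \<open>Put x = 1 / y, so that dx/dy = - x^2. The derivative of p(x) exp(-x) in x is (p'(x) -
  p(x)) exp(-x), whence the polynomial x^2 (p - p').\<close>

lemma flat_exp_deriv:
  "(flat_exp p has_real_derivative flat_exp ([:0, 0, 1:] * (p - pderiv p)) y) (at y)"
proof -
  consider "y > 0" | "y < 0" | "y = 0" by linarith
  then show ?thesis
  proof cases
    case 1
    have "((\<lambda>y. poly p (1 / y) * exp (- (1 / y))) has_real_derivative
             flat_exp ([:0, 0, 1:] * (p - pderiv p)) y) (at y)"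
      using 1 unfolding flat_exp_def
      by (auto intro!: derivative_eq_intros DERIV_chain2[where f="poly p"] poly_DERIV simp: field_simps)
    then show ?thesis
      by (rule has_field_derivative_transform_within_open[of _ _ _ "{0<..}"])
         (use 1 in \<open>auto simp: flat_exp_def\<close>)
  next
    case 2
    have "((\<lambda>y. 0) has_real_derivative flat_exp ([:0, 0, 1:] * (p - pderiv p)) y) (at y)"
      using 2 by (auto simp: flat_exp_def)
    then show ?thesis
      by (rule has_field_derivative_transform_within_open[of _ _ _ "{..<0}"])
         (use 2 in \<open>auto simp: flat_exp_def\<close>)
  next
    case 3
    then show ?thesis
      using flat_exp_quotient_tendsto_0[of p] by (simp add: has_field_derivative_iff flat_exp_def)
  qed
qed

lemma Ck_flat_exp: "Ck k (\<lambda>x::real^'n. c * flat_exp p (a * x $ i + b))"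
proof (induction k arbitrary: p c)
  case 0
  have "continuous_on UNIV (flat_exp p)"
    using flat_exp_deriv by (meson DERIV_continuous_on)
  then have "continuous_on UNIV (\<lambda>x::real^'n. flat_exp p (a * x $ i + b))"
    by (rule continuous_on_compose2) (intro continuous_intros subset_UNIV)+
  then show ?case by (simp add: continuous_on_mult_left)
next
  case (Suc k)
  let ?q = "[:0, 0, 1:] * (p - pderiv p)"
  have "((\<lambda>x::real^'n. a * x $ i + b) has_derivative (\<lambda>h. a * h $ i)) (at x)" for x
    by (auto intro!: derivative_eq_intros bounded_linear.has_derivative[OF bounded_linear_vec_nth])
  from has_derivative_compose[OF this flat_exp_deriv[unfolded has_field_derivative_def]]
  have D: "((\<lambda>x::real^'n. c * flat_exp p (a * x $ i + b)) has_derivative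
             (\<lambda>h. c * (flat_exp ?q (a * x $ i + b) * (a * h $ i)))) (at x)" for x
    by (rule has_derivative_mult_right)
  have "gradient (\<lambda>x. c * flat_exp p (a * x $ i + b)) x $ j
          = (c * a * (axis j 1 :: real^'n) $ i) * flat_exp ?q (a * x $ i + b)" for x j
    unfolding gradient_eqI[OF D] by simp
  moreover have "(\<lambda>x::real^'n. c * flat_exp p (a * x $ i + b)) differentiable (at x)" for x
    using D[of x] by (auto simp: differentiable_def)
  ultimately show ?case
    using Suc by auto
qed

text \<open>\<open>flat_exp 1\<close> is exp(-1/y) for y > 0 and 0 otherwise, with limit 1 at
  infinity. The product over all faces is positive exactly inside the open box, and stretching by n
  + 1 drives each factor to 1 there. Positivity inside is recorded because these functions also
  serve as localising weights.\<close>

lemma box_indicator_approximation: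
  fixes a b :: "real^'n"
  obtains \<phi> where "\<And>n::nat. test_function (\<phi> n)" "\<And>n x. 0 \<le> \<phi> n x" "\<And>n x. \<phi> n x \<le> 1"
    "\<And>x. (\<lambda>n. \<phi> n x) \<longlonglongrightarrow> indicator (box a b) x"
    "\<And>n x. x \<in> box a b \<Longrightarrow> 0 < \<phi> n x"
proof -
  let ?E = "flat_exp 1"
  define \<phi> where "\<phi> n x = (\<Prod>i\<in>UNIV. ?E (real (Suc n) * (x $ i - a $ i)) * ?E (real (Suc n) * (b $ i - x $ i)))"
    for n and x :: "real^'n"
  have E: "?E y \<ge> 0" "?E y \<le> 1" "y > 0 \<Longrightarrow> ?E y > 0" "y \<le> 0 \<Longrightarrow> ?E y = 0" for y
    by (auto simp: flat_exp_def)
  have zero: "\<phi> n x = 0" if "x \<notin> box a b" for n x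
  proof -
    have "\<exists>i. x $ i \<le> a $ i \<or> b $ i \<le> x $ i"
      using that unfolding mem_box_cart by (meson not_less)
    then obtain i where "x $ i \<le> a $ i \<or> b $ i \<le> x $ i" ..
    then have "?E (real (Suc n) * (x $ i - a $ i)) * ?E (real (Suc n) * (b $ i - x $ i)) = 0"
      by (auto simp: E(4) mult_nonneg_nonpos)
    then show ?thesis unfolding \<phi>_def by (meson UNIV_I finite prod_zero)
  qed
  have pos: "0 < \<phi> n x" if "x \<in> box a b" for n x
    using that unfolding \<phi>_def
    by (intro prod_pos ballI mult_pos_pos E(3)) (auto simp: mem_box_cart)
  show thesis
  proof
    fix n
    have "\<phi> n = (\<lambda>x. \<Prod>i\<in>UNIV. (1 * ?E (real (Suc n) * x $ i + - (real (Suc n) * a $ i))) *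
                         (1 * ?E (- real (Suc n) * x $ i + real (Suc n) * b $ i)))"
      unfolding \<phi>_def by (simp add: algebra_simps)
    then have "Ck k (\<phi> n)" for k
      by (simp only:) (intro Ck_prod Ck_mult Ck_flat_exp finite)
    moreover have "{x. \<phi> n x \<noteq> 0} \<subseteq> cbox a b"
      using zero box_subset_cbox by blast
    then have "closure {x. \<phi> n x \<noteq> 0} \<subseteq> cbox a b"
      by (intro closure_minimal closed_cbox)
    then have "compact (closure {x. \<phi> n x \<noteq> 0})"
      by (meson bounded_cbox bounded_subset closed_closure compact_eq_bounded_closed)
    ultimately show "test_function (\<phi> n)" by (simp add: test_function_def)
  next
    show "0 \<le> \<phi> n x" "\<phi> n x \<le> 1" for n x
      using E unfolding \<phi>_def by (auto intro!: prod_nonneg prod_le_1 mult_le_one)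
  next
    fix x
    have lim1: "(\<lambda>n. ?E (real (Suc n) * c)) \<longlonglongrightarrow> 1" if "c > 0" for c
    proof -
      have "(\<lambda>n. exp (- (1 / c * (1 / real (Suc n))))) \<longlonglongrightarrow> exp (- (1 / c * 0))"
        by (intro tendsto_intros LIMSEQ_inverse_real_of_nat[unfolded inverse_eq_divide])
      with that show ?thesis by (simp add: flat_exp_def mult.commute)
    qed
    show "(\<lambda>n. \<phi> n x) \<longlonglongrightarrow> indicator (box a b) x"
    proof (cases "x \<in> box a b")
      case True
      have "(\<lambda>n. \<phi> n x) \<longlonglongrightarrow> (\<Prod>i\<in>(UNIV::'n set). 1 * 1)"
        using True unfolding \<phi>_def by (intro tendsto_prod tendsto_mult lim1) (auto simp: mem_box_cart)
      with True show ?thesis by simp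
    qed (simp add: zero)
  qed (use pos in auto)
qed

text \<open>Integrability is available only for products of \<open>u\<close> with test functions. So
  \<open>u\<close> is multiplied by a fixed test function \<open>\<eta>\<close>, and the integrable
  product is shown to have zero integral over every Borel set; weights that are positive on growing
  boxes then remove \<open>\<eta>\<close>.\<close>

lemma AE_zero_if_test_integrals_zero:
  fixes \<mu> :: "(real^'n) measure" and u :: "real^'n \<Rightarrow> real"
  assumes "sigma_finite_measure \<mu>"
    and sets[measurable_cong]: "sets \<mu> = sets borel"
    and u[measurable]: "u \<in> borel_measurable borel"
    and int: "\<And>\<phi>. test_function \<phi> \<Longrightarrow> integrable \<mu> (\<lambda>x. \<phi> x * u x)"
    and zero: "\<And>\<phi>. test_function \<phi> \<Longrightarrow> (LINT x|\<mu>. \<phi> x * u x) = 0"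
  shows "AE x in \<mu>. u x = 0"
proof -
  interpret sigma_finite_measure \<mu> by fact
  have localized: "AE x in \<mu>. \<eta> x * u x = 0" if \<eta>: "test_function \<eta>" for \<eta>
  proof (rule density_zero)
    let ?v = "\<lambda>x. \<eta> x * u x"
    show v: "integrable \<mu> ?v" using \<eta> by (rule int)
    have space: "space \<mu> = UNIV" using sets_eq_imp_space_eq[OF sets] by simp
    have set_int: "set_integrable \<mu> A ?v" if "A \<in> sets borel" for A
      unfolding set_integrable_def using that sets v by (intro integrable_mult_indicator) auto
    fix A assume "A \<in> sets \<mu>"
    then have gen: "A \<in> sigma_sets UNIV (range (\<lambda>(a, b). box a b))"
      using sets by (simp add: borel_eq_box)
    \<comment> \<open>Open boxes form an intersection-stable generator, so boxes, complements and
      disjoint unions are all that has to be treated.\<close>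
    have "Int_stable (range (\<lambda>(a, b). box a b :: (real^'n) set))"
      by (auto simp: Int_stable_def box_Int_box)
    moreover have "range (\<lambda>(a, b). box a b :: (real^'n) set) \<subseteq> Pow UNIV" by simp
    ultimately show "(LINT x:A|\<mu>. ?v x) = 0" using gen
    proof (induction rule: sigma_sets_induct_disjoint)
      case (basic A)
      then obtain a b where A: "A = box a b" by auto
      obtain \<phi> where \<phi>: "\<And>n::nat. test_function (\<phi> n)" "\<And>n x. 0 \<le> \<phi> n x" "\<And>n x. \<phi> n x \<le> 1"
        "\<And>x. (\<lambda>n. \<phi> n x) \<longlonglongrightarrow> indicator (box a b) x"
        using box_indicator_approximation[of a b] by metis
      have [measurable]: "\<phi> n \<in> borel_measurable borel" "\<eta> \<in> borel_measurable borel" for n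
        using test_function_continuous(1)[OF \<phi>(1)] test_function_continuous(1)[OF \<eta>]
        by (auto intro: borel_measurable_continuous_onI)
      \<comment> \<open>Each \<phi>_n \<eta> is again a test function, so the approximating
        integrals vanish, and the integrable function |\<eta> u| dominates them.\<close>
      have "(\<lambda>n. LINT x|\<mu>. \<phi> n x * ?v x) \<longlonglongrightarrow> (LINT x|\<mu>. indicator (box a b) x * ?v x)"
      proof (rule integral_dominated_convergence)
        show "integrable \<mu> (\<lambda>x. norm (?v x))" using v by (rule integrable_norm)
        show "AE x in \<mu>. (\<lambda>n. \<phi> n x * ?v x) \<longlonglongrightarrow> indicator (box a b) x * ?v x"
          by (intro AE_I2 tendsto_mult tendsto_const \<phi>)
        show "AE x in \<mu>. norm (\<phi> n x * ?v x) \<le> norm (?v x)" for n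
          unfolding norm_mult[of "\<phi> n _"] using \<phi>(2,3) by (intro AE_I2 mult_left_le_one_le) auto
      qed auto
      moreover have "(LINT x|\<mu>. \<phi> n x * ?v x) = 0" for n
        using zero[OF test_function_mult[OF \<phi>(1) \<eta>]] by (simp add: mult.assoc)
      ultimately show ?case
        by (simp add: A set_lebesgue_integral_def LIMSEQ_const_iff)
    next
      case empty
      show ?case by (simp add: set_lebesgue_integral_def)
    next
      case (compl A)
      then have A: "A \<in> sets borel" by (simp add: borel_eq_box)
      have disj: "(UNIV - A) \<inter> A = {}" by blast
      \<comment> \<open>The complement needs the integral over the whole space to vanish; this is
        the hypothesis for the test function \<open>\<eta>\<close> itself.\<close>
      have "(LINT x:UNIV - A|\<mu>. ?v x) = (LINT x|\<mu>. ?v x) - (LINT x:A|\<mu>. ?v x)"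
        using set_integral_Un[OF disj, of \<mu> ?v] set_int[OF A] set_int[of "UNIV - A"] A
        by (simp add: space set_lebesgue_integral_def)
      with compl zero[OF \<eta>] show ?case by simp
    next
      case (union A)
      have A: "A i \<in> sets borel" for i
        using union.hyps(2) by (auto simp: borel_eq_box)
      have "(LINT x:(\<Union>i. A i)|\<mu>. ?v x) = (\<Sum>i. LINT x:A i|\<mu>. ?v x)"
        using A union.hyps(1) sets
        by (intro lebesgue_integral_countable_add set_int) (auto simp: disjoint_family_on_def)
      with union.IH show ?case by simp
    qed
  qed
  \<comment> \<open>Boxes of half-width N exhaust the space, so countably many weights, and
    countably many exceptional null sets, suffice.\<close>
  have "\<exists>\<eta>. test_function \<eta> \<and> (\<forall>x \<in> box (- (real N *\<^sub>R One :: real^'n)) (real N *\<^sub>R One). 0 < \<eta> x)" for N :: nat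
    using box_indicator_approximation[of "- (real N *\<^sub>R One :: real^'n)" "real N *\<^sub>R One"] by metis
  then obtain \<eta> where \<eta>: "\<And>N. test_function (\<eta> N)"
      "\<And>N x. x \<in> box (- (real N *\<^sub>R One :: real^'n)) (real N *\<^sub>R One) \<Longrightarrow> 0 < \<eta> N x"
    by metis
  have "AE x in \<mu>. \<forall>N. \<eta> N x * u x = 0"
    unfolding AE_all_countable using localized[OF \<eta>(1)] by blast
  then show ?thesis
  proof (rule eventually_mono)
    fix x assume x: "\<forall>N. \<eta> N x * u x = 0"
    obtain N :: nat where "x \<in> box (- (real N *\<^sub>R One)) (real N *\<^sub>R One)"
      using UN_box_eq_UNIV by blast
    with \<eta>(2)[OF this] x show "u x = 0" by (metis less_irrefl mult_eq_0_iff)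
  qed
qed

subsection \<open>Factorisation through the conditioning variable\<close>

text \<open>This is the Doob-Dynkin lemma. A score is a function of position, whereas a conditional
  expectation given \<open>V\<close> is a function on the probability space, measurable for the
  sigma-algebra of \<open>V\<close>.\<close>

lemma borel_measurable_vimage_algebra_factor:
  fixes f :: "'a \<Rightarrow> real"
  assumes V: "V \<in> \<Omega> \<rightarrow> space N" and f: "f \<in> borel_measurable (vimage_algebra \<Omega> V N)"
  obtains w where "w \<in> borel_measurable N" "\<And>x. x \<in> \<Omega> \<Longrightarrow> f x = w (V x)"
proof -
  let ?P = "\<lambda>u::'a \<Rightarrow> real. \<exists>w\<in>borel_measurable N. \<forall>x\<in>\<Omega>. u x = w (V x)"
  have nonneg: "?P u" if "u \<in> borel_measurable (vimage_algebra \<Omega> V N)" "\<And>x. 0 \<le> u x" for u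
    using that
  proof (induction rule: borel_measurable_induct_real)
    case (set A)
    then obtain B where "B \<in> sets N" "A = V -` B \<inter> \<Omega>"
      using V by (auto simp: sets_vimage_algebra2)
    then show ?case by (intro bexI[of _ "indicator B"]) (auto simp: indicator_def)
  next
    case (mult u c)
    then obtain w where "w \<in> borel_measurable N" "\<forall>x\<in>\<Omega>. u x = w (V x)" by blast
    then show ?case by (intro bexI[of _ "\<lambda>y. c * w y"]) auto
  next
    case (add u v)
    then obtain w w' where "w \<in> borel_measurable N" "\<forall>x\<in>\<Omega>. u x = w (V x)"
      "w' \<in> borel_measurable N" "\<forall>x\<in>\<Omega>. v x = w' (V x)" by blast
    then show ?case by (intro bexI[of _ "\<lambda>y. w' y + w y"]) auto
  next
    case (seq U)
    from seq.IH obtain w where w: "\<And>i. w i \<in> borel_measurable N" "\<And>i x. x \<in> \<Omega> \<Longrightarrow> U i x = w i (V x)"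
      by metis
    \<comment> \<open>Off the range of \<open>V\<close> the sequence may diverge and
      \<open>lim\<close> takes a meaningless value; the limit function is still measurable, and only
      its values at points \<open>V x\<close> matter.\<close>
    have "u x = lim (\<lambda>i. w i (V x))" if "x \<in> \<Omega>" for x
      using seq.hyps(4)[of x] that w(2) by (simp add: limI)
    with w(1) show ?case
      by (intro bexI[of _ "\<lambda>y. lim (\<lambda>i. w i y)"]) (auto intro: borel_measurable_lim_metric)
  qed
  have "?P (\<lambda>x. max 0 (f x))" "?P (\<lambda>x. max 0 (- f x))"
    using f by (auto intro!: nonneg)
  then obtain v w where vw: "v \<in> borel_measurable N" "w \<in> borel_measurable N"
    "\<forall>x\<in>\<Omega>. max 0 (f x) = v (V x)" "\<forall>x\<in>\<Omega>. max 0 (- f x) = w (V x)"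
    by blast
  show thesis
  proof
    show "(\<lambda>y. v y - w y) \<in> borel_measurable N" using vw by auto
    show "f x = v (V x) - w (V x)" if "x \<in> \<Omega>" for x
      using vw(3,4) that by (auto simp: max_def split: if_splits dest!: bspec[of _ _ x])
  qed
qed

subsection \<open>Gaussian integration by parts\<close>

lemma lborel_integral_shift:
  fixes h :: "'a::euclidean_space \<Rightarrow> real"
  assumes "integrable lborel h"
  shows "integrable lborel (\<lambda>x. h (x + c))" "(LINT x|lborel. h (x + c)) = integral\<^sup>L lborel h"
proof -
  have h: "h \<in> borel_measurable borel" using assms by auto
  have "integrable (distr lborel borel ((+) c)) h" using assms by (simp add: lborel_distr_plus)
  then show "integrable lborel (\<lambda>x. h (x + c))"
    using h by (simp add: integrable_distr_eq add.commute)
  show "(LINT x|lborel. h (x + c)) = integral\<^sup>L lborel h"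
    using integral_distr[of "(+) c" lborel borel h] h by (simp add: lborel_distr_plus add.commute)
qed

text \<open>Integrate \<open>h'\<close> along the segment from x to x + e and over all x. In one
  order the fundamental theorem leaves the integral of h(x + e) - h(x), which is 0 by translation
  invariance; in the other, every translate of \<open>h'\<close> contributes the same integral. No
  boundary terms arise, so integrability replaces any decay at infinity.\<close>

lemma integral_directional_derivative_eq_0:
  fixes h h' :: "'a::euclidean_space \<Rightarrow> real"
  assumes deriv: "\<And>x s. ((\<lambda>s. h (x + s *\<^sub>R e)) has_real_derivative h' (x + s *\<^sub>R e)) (at s)"
    and cont: "continuous_on UNIV h'"
    and h: "integrable lborel h" and h': "integrable lborel h'"
  shows "integral\<^sup>L lborel h' = 0"
proof -
  have [measurable]: "h' \<in> borel_measurable borel" using h' by auto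
  let ?k = "\<lambda>(u, x). h' (x + u *\<^sub>R e) * indicator {0..1} u"
  have k: "integrable (lborel \<Otimes>\<^sub>M lborel) ?k"
  proof (rule lborel_pair.Fubini_integrable)
    have "(LINT x|lborel. norm (?k (u, x))) = (LINT x|lborel. norm (h' x)) * indicator {0..1} u" for u
      using lborel_integral_shift(2)[OF integrable_norm[OF h'], of "u *\<^sub>R e"]
      by (simp add: abs_mult)
    then show "integrable lborel (\<lambda>u::real. LINT x|lborel. norm (?k (u, x)))"
      by simp
    show "AE u in lborel. integrable lborel (\<lambda>x. ?k (u, x))"
      using lborel_integral_shift(1)[OF h'] by simp
  qed measurable
  have "(LINT x|lborel. LINT u|lborel. ?k (u, x)) = (LINT x|lborel. h (x + e) - h x)"
  proof (rule Bochner_Integration.integral_cong[OF refl])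
    fix x
    have "isCont (\<lambda>u. h' (x + u *\<^sub>R e)) s" for s
      by (intro continuous_within_compose3[where g=h' and f="\<lambda>u. x + u *\<^sub>R e"] continuous_intros)
         (use cont in \<open>auto simp: continuous_on_eq_continuous_at\<close>)
    then have "(LINT u|lborel. h' (x + u *\<^sub>R e) * indicator {0..1} u) = h (x + 1 *\<^sub>R e) - h (x + 0 *\<^sub>R e)"
      by (intro integral_FTC_Icc_real deriv) auto
    then show "(LINT u|lborel. ?k (u, x)) = h (x + e) - h x" by simp
  qed
  also have "\<dots> = 0"
    using lborel_integral_shift[OF h, of e] h by simp
  finally have zero: "(LINT u|lborel. LINT x|lborel. ?k (u, x)) = 0"
    using lborel_pair.Fubini_integral[of "\<lambda>u x. ?k (u, x)"] k by simp
  have inner: "(LINT x|lborel. ?k (u, x)) = integral\<^sup>L lborel h' * indicator {0..1} u" for u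
    using lborel_integral_shift(2)[OF h'] by simp
  have "(LINT u|lborel. LINT x|lborel. ?k (u, x)) = integral\<^sup>L lborel h'"
    unfolding inner by simp
  with zero show ?thesis by simp
qed

lemma lborel_integrable_scale:
  fixes f :: "'a::euclidean_space \<Rightarrow> real"
  assumes f: "integrable lborel f" and a: "a \<noteq> 0"
  shows "integrable lborel (\<lambda>x. f (a *\<^sub>R x))"
proof -
  have [measurable]: "f \<in> borel_measurable borel" using f by auto
  have "integrable (density (distr lborel borel (\<lambda>x::'a. 0 + a *\<^sub>R x)) (\<lambda>_. ennreal (\<bar>a\<bar> ^ DIM('a)))) f"
    using f lborel_affine[OF a, of "0::'a"] by (simp add: ennreal_power)
  then have "integrable (distr lborel borel (\<lambda>x::'a. 0 + a *\<^sub>R x)) (\<lambda>x. \<bar>a\<bar> ^ DIM('a) *\<^sub>R f x)"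
    by (subst (asm) integrable_density) auto
  then have "integrable (distr lborel borel (\<lambda>x::'a. 0 + a *\<^sub>R x)) (\<lambda>x. (1 / \<bar>a\<bar> ^ DIM('a)) * (\<bar>a\<bar> ^ DIM('a) *\<^sub>R f x))"
    by (rule integrable_mult_right)
  then have "integrable (distr lborel borel (\<lambda>x::'a. 0 + a *\<^sub>R x)) f"
    using a by simp
  then show ?thesis by (simp add: integrable_distr_eq)
qed

lemma inner_matrix_symmetric:
  fixes G :: "real^'n^'n"
  assumes "transpose G = G"
  shows "x \<bullet> (G *v y) = y \<bullet> (G *v x)"
  by (metis assms dot_lmul_matrix inner_commute transpose_matrix_vector)

text \<open>The normalisation is an abstract positive \<open>K\<close>, because integration by parts
  does not see its value. Its positivity and the integrability of \<open>g\<close> are later read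
  off from the fact that a law has total mass one.\<close>

locale gaussian_weight =
  fixes G :: "real^'n^'n" and c K :: real and g :: "real^'n \<Rightarrow> real"
  assumes symmetric: "transpose G = G"
    and c_pos: "0 < c"
    and coercive: "c * (norm z)\<^sup>2 \<le> z \<bullet> (G *v z)"
    and K_pos: "0 < K"
    and g_eq: "g z = exp (- (z \<bullet> (G *v z)) / 2) / K"
    and g_integrable: "integrable lborel g"
begin

lemma g_nonneg: "0 \<le> g z"
  using K_pos by (simp add: g_eq)

lemma g_continuous: "continuous_on UNIV g"
  unfolding g_eq by (intro continuous_intros) (use K_pos in auto)

lemma g_has_derivative: "(g has_derivative (\<lambda>h. - (h \<bullet> (G *v z)) * g z)) (at z)"
proof -
  have "((\<lambda>z. z \<bullet> (G *v z)) has_derivative (\<lambda>h. z \<bullet> (G *v h) + h \<bullet> (G *v z))) (at z)"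
    by (intro has_derivative_inner has_derivative_ident
        bounded_linear.has_derivative[OF matrix_vector_mul_bounded_linear])
  then have "((\<lambda>z. z \<bullet> (G *v z)) has_derivative (\<lambda>h. 2 * (h \<bullet> (G *v z)))) (at z)"
    by (simp add: inner_matrix_symmetric[OF symmetric, of z])
  then have "((\<lambda>z. exp (- (1/2) * (z \<bullet> (G *v z)))) has_derivative
      (\<lambda>h. - (1/2) * (2 * (h \<bullet> (G *v z))) * exp (- (1/2) * (z \<bullet> (G *v z))))) (at z)"
    by (intro has_derivative_exp has_derivative_mult_right)
  then have "((\<lambda>z. exp (- (1/2) * (z \<bullet> (G *v z))) * (1 / K)) has_derivative
      (\<lambda>h. - (1/2) * (2 * (h \<bullet> (G *v z))) * exp (- (1/2) * (z \<bullet> (G *v z))) * (1 / K))) (at z)"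
    by (rule has_derivative_mult_left)
  then show ?thesis by (simp add: g_eq[abs_def] mult.commute)
qed

text \<open>With q the quadratic form at z, half of the exponent pays for the polynomial factor:
  |z|^2 \<le> q / c \<le> (4 / c) exp(q / 4), and exp(q / 4) exp(- q / 2) = exp(- q / 4) is the
  exponential in \<open>g\<close> at z / sqrt 2. So integrability of \<open>g\<close> and of a
  rescaled copy is enough.\<close>

lemma second_moment: "integrable lborel (\<lambda>z. (1 + (norm z)\<^sup>2) * g z)"
proof -
  have [measurable]: "g \<in> borel_measurable borel"
    using g_integrable by auto
  have "integrable lborel (\<lambda>z. g z + 4 / c * g ((1 / sqrt 2) *\<^sub>R z))"
    by (intro Bochner_Integration.integrable_add integrable_mult_right g_integrable lborel_integrable_scale) auto
  then show ?thesis
  proof (rule Bochner_Integration.integrable_bound)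
    show "AE z in lborel. norm ((1 + (norm z)\<^sup>2) * g z) \<le> norm (g z + 4 / c * g ((1 / sqrt 2) *\<^sub>R z))"
    proof (intro AE_I2)
      fix z
      let ?q = "z \<bullet> (G *v z)"
      have "((1 / sqrt 2) *\<^sub>R z) \<bullet> (G *v ((1 / sqrt 2) *\<^sub>R z)) = ?q / 2"
        by (simp add: matrix_vector_mult_scaleR)
      then have scaled: "g ((1 / sqrt 2) *\<^sub>R z) = exp (- ?q / 4) / K"
        unfolding g_eq by (simp only:) simp
      have "(norm z)\<^sup>2 \<le> ?q / c"
        using coercive[of z] c_pos by (simp add: pos_le_divide_eq mult.commute)
      also have "\<dots> \<le> 4 / c * exp (?q / 4)"
        using exp_ge_add_one_self[of "?q / 4"] c_pos by (auto simp: field_simps)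
      finally have "(norm z)\<^sup>2 * g z \<le> 4 / c * exp (?q / 4) * g z"
        using g_nonneg by (rule mult_right_mono)
      also have "\<dots> = 4 / c * g ((1 / sqrt 2) *\<^sub>R z)"
        unfolding scaled by (simp add: g_eq flip: exp_add)
      finally show "norm ((1 + (norm z)\<^sup>2) * g z) \<le> norm (g z + 4 / c * g ((1 / sqrt 2) *\<^sub>R z))"
        using g_nonneg c_pos by (simp add: distrib_right)
    qed
  qed measurable
qed

lemma integrable_quadratic_growth:
  assumes [measurable]: "f \<in> borel_measurable borel" and bound: "\<And>z. \<bar>f z\<bar> \<le> B * (1 + (norm z)\<^sup>2)"
  shows "integrable lborel (\<lambda>z. f z * g z)"
proof (rule Bochner_Integration.integrable_bound[OF integrable_mult_right[OF second_moment, of B]])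
  have [measurable]: "g \<in> borel_measurable borel"
    using g_integrable by auto
  show "(\<lambda>z. f z * g z) \<in> borel_measurable lborel" by measurable
  show "AE z in lborel. norm (f z * g z) \<le> norm (B * ((1 + (norm z)\<^sup>2) * g z))"
  proof (intro AE_I2)
    fix z
    have "norm (f z * g z) = \<bar>f z\<bar> * g z" using g_nonneg by (simp add: abs_mult)
    also have "\<dots> \<le> (B * (1 + (norm z)\<^sup>2)) * g z"
      by (rule mult_right_mono[OF bound g_nonneg])
    also have "\<dots> \<le> norm (B * ((1 + (norm z)\<^sup>2) * g z))" by (simp add: mult.assoc)
    finally show "norm (f z * g z) \<le> norm (B * ((1 + (norm z)\<^sup>2) * g z))" .
  qed
qed

text \<open>Since \<open>\<nabla>g = - g \<cdot> Gz\<close>, this is the vanishing of the integral of the \<open>i\<close>-th partial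
  derivative of \<open>\<psi> g\<close>.\<close>

lemma integration_by_parts:
  assumes diff: "\<And>z. \<psi> differentiable (at z)"
    and cont: "continuous_on UNIV (\<lambda>z. gradient \<psi> z $ i)"
    and bound: "\<And>z. \<bar>\<psi> z\<bar> \<le> A * (1 + norm z)" "\<And>z. \<bar>gradient \<psi> z $ i\<bar> \<le> A"
  shows "integrable lborel (\<lambda>z. \<psi> z * (G *v z) $ i * g z)"
    and "integrable lborel (\<lambda>z. gradient \<psi> z $ i * g z)"
    and "(LINT z|lborel. \<psi> z * (G *v z) $ i * g z) = (LINT z|lborel. gradient \<psi> z $ i * g z)"
proof -
  have cont_\<psi>: "continuous_on UNIV \<psi>"
    using diff by (auto intro!: continuous_at_imp_continuous_on differentiable_imp_continuous_within)
  have cont_G: "continuous_on UNIV (\<lambda>z. (G *v z) $ i)"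
    by (intro continuous_intros)
  have A: "0 \<le> A" using bound(2)[of 0] by linarith
  obtain B where B: "B > 0" "\<And>z. norm (G *v z) \<le> norm z * B"
    using bounded_linear.pos_bounded[OF matrix_vector_mul_bounded_linear[of G]] by blast
  \<comment> \<open>Linear growth is converted into the quadratic growth that
    \<open>second_moment\<close> controls; completing the square gives 2 a^2 - a + 1 = 2 (a - 1/4)^2
    + 7/8.\<close>
  have sq: "1 + a \<le> 2 * (1 + a\<^sup>2)" for a :: real
  proof -
    have "2 * (1 + a\<^sup>2) - (1 + a) = 2 * (a - 1/4)\<^sup>2 + 7 / 8"
      by (simp add: power2_eq_square field_simps)
    moreover have "0 \<le> (a - 1/4)\<^sup>2" by simp
    ultimately show ?thesis by linarith
  qed
  have b0: "\<bar>\<psi> z\<bar> \<le> 2 * A * (1 + (norm z)\<^sup>2)" for z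
  proof -
    have "A * (1 + norm z) \<le> A * (2 * (1 + (norm z)\<^sup>2))"
      by (intro mult_left_mono A sq)
    with bound(1)[of z] show ?thesis by linarith
  qed
  \<comment> \<open>One power of |z| comes from \<psi> and one from \<open>G *v z\<close>, which is
    just what a second moment can carry.\<close>
  have b1: "\<bar>\<psi> z * (G *v z) $ i\<bar> \<le> 2 * A * B * (1 + (norm z)\<^sup>2)" for z
  proof -
    have "\<bar>\<psi> z * (G *v z) $ i\<bar> \<le> (A * (1 + norm z)) * (norm z * B)"
      unfolding abs_mult using bound(1)[of z] B(2)[of z] component_le_norm_cart[of "G *v z" i]
      by (intro mult_mono) (auto intro: order_trans abs_ge_zero)
    also have "\<dots> = (A * B) * (norm z + (norm z)\<^sup>2)" by (simp add: power2_eq_square algebra_simps)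
    also have "\<dots> \<le> (A * B) * (2 * (1 + (norm z)\<^sup>2))"
    proof (rule mult_left_mono)
      show "norm z + (norm z)\<^sup>2 \<le> 2 * (1 + (norm z)\<^sup>2)"
        using sq[of "norm z"] zero_le_power2[of "norm z"] zero_le_power2[of "norm z - 1"]
        unfolding power2_diff by simp
    qed (use A B(1) in simp)
    finally show ?thesis by (simp add: mult.assoc mult.left_commute)
  qed
  have b2: "\<bar>gradient \<psi> z $ i\<bar> \<le> A * (1 + (norm z)\<^sup>2)" for z
    using bound(2)[of z] A mult_left_mono[of 1 "1 + (norm z)\<^sup>2" A] by simp
  show int1: "integrable lborel (\<lambda>z. \<psi> z * (G *v z) $ i * g z)"
    by (rule integrable_quadratic_growth[OF _ b1])
       (intro borel_measurable_continuous_onI continuous_intros cont_\<psi> cont_G)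
  show int2: "integrable lborel (\<lambda>z. gradient \<psi> z $ i * g z)"
    by (rule integrable_quadratic_growth[OF _ b2]) (intro borel_measurable_continuous_onI cont)
  have int0: "integrable lborel (\<lambda>z. \<psi> z * g z)"
    by (rule integrable_quadratic_growth[OF _ b0]) (intro borel_measurable_continuous_onI cont_\<psi>)
  define h' where "h' z = gradient \<psi> z $ i * g z - \<psi> z * (G *v z) $ i * g z" for z
  have "integral\<^sup>L lborel h' = 0"
  proof (rule integral_directional_derivative_eq_0[where e="axis i 1" and h="\<lambda>z. \<psi> z * g z"])
    fix z :: "real^'n" and s :: real
    let ?z = "z + s *\<^sub>R axis i 1"
    have "((\<lambda>s. z + s *\<^sub>R axis i 1) has_derivative (\<lambda>h. h *\<^sub>R axis i 1)) (at s)"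
      by (auto intro!: derivative_eq_intros)
    from has_derivative_compose[OF this
        has_derivative_mult[OF differentiable_has_derivative[OF diff] g_has_derivative]]
    have "((\<lambda>s. \<psi> (z + s *\<^sub>R axis i 1) * g (z + s *\<^sub>R axis i 1)) has_derivative
       (\<lambda>h. \<psi> ?z * (- ((h *\<^sub>R axis i 1) \<bullet> (G *v ?z)) * g ?z)
            + frechet_derivative \<psi> (at ?z) (h *\<^sub>R axis i 1) * g ?z)) (at s)" .
    moreover have "frechet_derivative \<psi> (at ?z) (h *\<^sub>R axis i 1) = h * gradient \<psi> ?z $ i" for h
      using linear_frechet_derivative[OF diff[of ?z]] by (simp add: linear_cmul gradient_def)
    moreover have "axis i 1 \<bullet> v = v $ i" for v :: "real^'n"
      by (simp add: inner_axis')
    ultimately show "((\<lambda>s. \<psi> (z + s *\<^sub>R axis i 1) * g (z + s *\<^sub>R axis i 1))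
        has_real_derivative h' ?z) (at s)"
      unfolding has_field_derivative_def h'_def
      by (elim has_derivative_eq_rhs) (simp add: fun_eq_iff algebra_simps)
  next
    show "continuous_on UNIV h'"
      unfolding h'_def by (intro continuous_intros cont cont_\<psi> cont_G g_continuous)
    show "integrable lborel h'"
      unfolding h'_def by (intro Bochner_Integration.integrable_diff int1 int2)
  qed (rule int0)
  then show "(LINT z|lborel. \<psi> z * (G *v z) $ i * g z) = (LINT z|lborel. gradient \<psi> z $ i * g z)"
    unfolding h'_def using int1 int2 by simp
qed

end

subsection \<open>Vector-valued integrals\<close>

lemma integrable_vec_nth:
  fixes f :: "'a \<Rightarrow> 'b::euclidean_space^'n"
  shows "integrable M f \<Longrightarrow> integrable M (\<lambda>x. f x $ i)"
  by (rule integrable_bounded_linear[OF bounded_linear_vec_nth])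

lemma integral_vec_nth:
  fixes f :: "'a \<Rightarrow> 'b::euclidean_space^'n"
  shows "integrable M f \<Longrightarrow> integral\<^sup>L M f $ i = (LINT x|M. f x $ i)"
  by (rule integral_bounded_linear[OF bounded_linear_vec_nth, symmetric])

text \<open>A vector is the sum of its components put back at their positions, and each such
  placement is bounded linear; this reduces integrability and measurability to components.
  Components may lie in any Euclidean space, so matrices are covered by applying the reduction
  twice.\<close>

lemma bounded_linear_single_component:
  "bounded_linear (\<lambda>y::'b::euclidean_space. \<chi> j::'n::finite. if j = i then y else 0)"
  by (intro linear_conv_bounded_linear[THEN iffD1] linearI) (auto simp: vec_eq_iff)

lemma vec_sum_single_components:
  fixes v :: "'b::euclidean_space^'n"
  shows "v = (\<Sum>i\<in>UNIV. \<chi> j. if j = i then v $ i else 0)"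
  by (simp add: vec_eq_iff)

lemma integrable_componentwise:
  fixes f :: "'a \<Rightarrow> 'b::euclidean_space^'n"
  assumes "\<And>i. integrable M (\<lambda>x. f x $ i)"
  shows "integrable M f"
proof -
  have "integrable M (\<lambda>x. \<Sum>i\<in>UNIV. (\<chi> j. if j = i then f x $ i else 0) :: 'b^'n)"
    by (intro Bochner_Integration.integrable_sum integrable_bounded_linear[OF bounded_linear_single_component] assms)
  then show ?thesis by (simp flip: vec_sum_single_components)
qed

lemma borel_measurable_componentwise:
  fixes f :: "'a \<Rightarrow> 'b::euclidean_space^'n"
  assumes "\<And>i. (\<lambda>x. f x $ i) \<in> borel_measurable M"
  shows "f \<in> borel_measurable M"
proof -
  have "(\<lambda>y::'b. (\<chi> j. if j = i then y else 0) :: 'b^'n) \<in> borel_measurable borel" for i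
    by (intro borel_measurable_continuous_onI linear_continuous_on bounded_linear_single_component)
  then have "(\<lambda>x. \<Sum>i\<in>UNIV. (\<chi> j. if j = i then f x $ i else 0) :: 'b^'n) \<in> borel_measurable M"
    by (intro borel_measurable_sum measurable_compose[OF assms])
  then show ?thesis by (simp flip: vec_sum_single_components)
qed

lemma borel_measurable_vec_nth[measurable (raw)]:
  fixes f :: "'a \<Rightarrow> 'b::euclidean_space^'n"
  shows "f \<in> borel_measurable M \<Longrightarrow> (\<lambda>x. f x $ i) \<in> borel_measurable M"
  by (rule measurable_compose[OF _ borel_measurable_continuous_onI])
     (auto intro!: continuous_intros)

lemma bounded_bilinear_matrix_vector:
  "bounded_bilinear ((*v) :: real^'n^'m \<Rightarrow> real^'n \<Rightarrow> real^'m)"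
  unfolding bilinear_conv_bounded_bilinear[symmetric] bilinear_def
  by (auto intro!: linearI simp: algebra_simps scaleR_matrix_vector_assoc)

lemma borel_measurable_matrix_vector_mult[measurable (raw)]:
  fixes A :: "'a \<Rightarrow> real^'n^'m"
  assumes "A \<in> borel_measurable M" "v \<in> borel_measurable M"
  shows "(\<lambda>x. A x *v v x) \<in> borel_measurable M"
  using assms
  by (rule borel_measurable_continuous_Pair)
     (intro bounded_bilinear.continuous_on[OF bounded_bilinear_matrix_vector] continuous_intros)

lemma integrable_bounded_scaleR:
  fixes f :: "'a \<Rightarrow> 'b::{banach, second_countable_topology}"
  assumes "integrable M f" "a \<in> borel_measurable M" "\<And>x. \<bar>a x\<bar> \<le> B"
  shows "integrable M (\<lambda>x. a x *\<^sub>R f x)"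
proof (rule Bochner_Integration.integrable_bound)
  show "integrable M (\<lambda>x. B * norm (f x))" using assms(1) by simp
  show "(\<lambda>x. a x *\<^sub>R f x) \<in> borel_measurable M" using assms(1,2) by measurable
  show "AE x in M. norm (a x *\<^sub>R f x) \<le> norm (B * norm (f x))"
    using assms(3) by (intro AE_I2) (force simp: abs_mult intro!: mult_right_mono order_trans[OF assms(3)])
qed

lemma integrable_bounded_matrix_vector:
  fixes A :: "'a \<Rightarrow> real^'n^'m"
  assumes "integrable M A" "v \<in> borel_measurable M" "\<And>x. norm (v x) \<le> B"
  shows "integrable M (\<lambda>x. A x *v v x)"
proof -
  obtain K where K: "K > 0" "\<And>A v. norm ((A :: real^'n^'m) *v v) \<le> norm A * norm v * K"
    using bounded_bilinear.pos_bounded[OF bounded_bilinear_matrix_vector] by metis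
  show ?thesis
  proof (rule Bochner_Integration.integrable_bound)
    show "integrable M (\<lambda>x. (B * K) * norm (A x))" using assms(1) by simp
    show "(\<lambda>x. A x *v v x) \<in> borel_measurable M" using assms(1,2) by measurable
    show "AE x in M. norm (A x *v v x) \<le> norm ((B * K) * norm (A x))"
    proof (intro AE_I2)
      fix x
      have "norm (A x *v v x) \<le> norm (A x) * norm (v x) * K" by (rule K)
      also have "\<dots> \<le> norm (A x) * B * K"
        using K(1) assms(3) by (intro mult_right_mono mult_left_mono) auto
      also have "\<dots> \<le> norm ((B * K) * norm (A x))" by (simp add: mult_ac)
      finally show "norm (A x *v v x) \<le> norm ((B * K) * norm (A x))" .
    qed
  qed
qed

lemma matrix_inv_cancel:
  assumes "invertible A"
  shows "A ** matrix_inv A = mat 1" "matrix_inv A ** A = mat 1"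
  using someI_ex[OF assms[unfolded invertible_def]] by (auto simp: matrix_inv_def)

lemma transpose_matrix_inv:
  fixes A :: "real^'n^'n"
  assumes "invertible A" "transpose A = A"
  shows "transpose (matrix_inv A) = matrix_inv A"
proof -
  have "transpose (matrix_inv A) ** A = mat 1"
    using matrix_inv_cancel(1)[OF assms(1)] assms(2) by (metis matrix_transpose_mul transpose_mat)
  then have "transpose (matrix_inv A) ** (A ** matrix_inv A) = matrix_inv A"
    by (simp add: matrix_mul_assoc)
  then show ?thesis by (simp add: matrix_inv_cancel(1)[OF assms(1)])
qed

subsection \<open>Covariance matrices\<close>

lemma integrable_product_of_square_integrable:
  fixes f h :: "'a \<Rightarrow> real"
  assumes [measurable]: "f \<in> borel_measurable M" "h \<in> borel_measurable M"
    and "integrable M (\<lambda>x. (f x)\<^sup>2)" "integrable M (\<lambda>x. (h x)\<^sup>2)"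
  shows "integrable M (\<lambda>x. f x * h x)"
proof (rule Bochner_Integration.integrable_bound)
  show "integrable M (\<lambda>x. (f x)\<^sup>2 + (h x)\<^sup>2)" using assms by simp
  show "AE x in M. norm (f x * h x) \<le> norm ((f x)\<^sup>2 + (h x)\<^sup>2)"
  proof (intro AE_I2)
    fix x
    have "0 \<le> (\<bar>f x\<bar> - \<bar>h x\<bar>)\<^sup>2" by simp
    then have "2 * (\<bar>f x\<bar> * \<bar>h x\<bar>) \<le> (f x)\<^sup>2 + (h x)\<^sup>2"
      by (simp add: power2_diff)
    moreover have "0 \<le> \<bar>f x\<bar> * \<bar>h x\<bar>" by simp
    ultimately show "norm (f x * h x) \<le> norm ((f x)\<^sup>2 + (h x)\<^sup>2)"
      by (simp only: real_norm_def abs_mult)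
  qed
qed measurable

lemma integrable_outer:
  fixes u v :: "'a \<Rightarrow> real^'n"
  assumes "\<And>i j. integrable M (\<lambda>x. u x $ i * v x $ j)"
  shows "integrable M (\<lambda>x. outer (u x) (v x))"
  using assms by (intro integrable_componentwise) (simp add: outer_def)

lemma integral_outer:
  fixes u v :: "'a \<Rightarrow> real^'n"
  assumes "\<And>i j. integrable M (\<lambda>x. u x $ i * v x $ j)"
  shows "(LINT x|M. outer (u x) (v x)) $ i $ j = (LINT x|M. u x $ i * v x $ j)"
proof -
  have 1: "integrable M (\<lambda>x. outer (u x) (v x))" by (rule integrable_outer) fact
  show ?thesis
    unfolding integral_vec_nth[OF 1] integral_vec_nth[OF integrable_vec_nth[OF 1]]
    by (simp add: outer_def)
qed

lemma (in finite_measure) square_integrable_components: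
  fixes X :: "'a \<Rightarrow> real^'n"
  assumes [measurable]: "X \<in> borel_measurable M" and sq: "integrable M (\<lambda>x. (norm (X x))\<^sup>2)"
  shows "integrable M (\<lambda>x. X x $ i * X x $ j)" "integrable M X"
proof -
  have comp: "integrable M (\<lambda>x. (X x $ i)\<^sup>2)" for i
    by (rule Bochner_Integration.integrable_bound[OF sq])
       (auto simp: component_le_norm_cart abs_le_square_iff[symmetric])
  then show "integrable M (\<lambda>x. X x $ i * X x $ j)"
    by (intro integrable_product_of_square_integrable) auto
  have "integrable M (\<lambda>x. X x $ i)" for i
    using integrable_product_of_square_integrable[of "\<lambda>x. X x $ i" M "\<lambda>_. 1"] comp[of i] by simp
  then show "integrable M X" by (rule integrable_componentwise)
qed

lemma covariance_matrix_centered: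
  fixes X :: "'a \<Rightarrow> real^'n"
  assumes "integral\<^sup>L M X = 0" "\<And>i j. integrable M (\<lambda>x. X x $ i * X x $ j)"
  shows "covariance_matrix M X $ i $ j = (LINT x|M. X x $ i * X x $ j)"
  unfolding covariance_matrix_def using integral_outer[OF assms(2)] by (simp add: assms(1))

lemma covariance_matrix_symmetric:
  fixes X :: "'a \<Rightarrow> real^'n"
  assumes "integral\<^sup>L M X = 0" "\<And>i j. integrable M (\<lambda>x. X x $ i * X x $ j)"
  shows "transpose (covariance_matrix M X) = covariance_matrix M X"
  by (simp add: vec_eq_iff transpose_def covariance_matrix_centered[OF assms] mult.commute)

lemma covariance_matrix_bilinear:
  fixes X :: "'a \<Rightarrow> real^'n"
  assumes "integral\<^sup>L M X = 0" and int: "\<And>i j. integrable M (\<lambda>x. X x $ i * X x $ j)"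
  shows "integrable M (\<lambda>x. (u \<bullet> X x) * (v \<bullet> X x))"
    and "(LINT x|M. (u \<bullet> X x) * (v \<bullet> X x)) = u \<bullet> (covariance_matrix M X *v v)"
proof -
  have expand: "(u \<bullet> X x) * (v \<bullet> X x) = (\<Sum>i\<in>UNIV. \<Sum>j\<in>UNIV. (u $ i * v $ j) * (X x $ i * X x $ j))" for x
    by (simp add: inner_vec_def sum_product mult_ac)
  show "integrable M (\<lambda>x. (u \<bullet> X x) * (v \<bullet> X x))"
    unfolding expand by (intro Bochner_Integration.integrable_sum integrable_mult_right int)
  have "(LINT x|M. (u \<bullet> X x) * (v \<bullet> X x)) = (\<Sum>i\<in>UNIV. \<Sum>j\<in>UNIV. (u $ i * v $ j) * (LINT x|M. X x $ i * X x $ j))"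
    unfolding expand by (subst Bochner_Integration.integral_sum, simp add: int)+ (simp add: int)
  then show "(LINT x|M. (u \<bullet> X x) * (v \<bullet> X x)) = u \<bullet> (covariance_matrix M X *v v)"
    by (simp add: covariance_matrix_centered[OF assms] inner_vec_def matrix_vector_mult_def
        sum_distrib_left mult_ac)
qed

text \<open>Instead of eigenvalues, the proof expands E[(z . X - T (w . X))^2] \<ge> 0, where w is
  the inverse covariance matrix applied to z. The mixed moment is |z|^2, the moment of w . X is z .
  w, and Cauchy-Schwarz bounds that of z . X by |z|^2 (T - 1). This leaves |z|^2 \<le> T (z .
  w).\<close>

lemma covariance_matrix_inverse_coercive:
  fixes X :: "'a \<Rightarrow> real^'n"
  assumes "integral\<^sup>L M X = 0" and int: "\<And>i j. integrable M (\<lambda>x. X x $ i * X x $ j)"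
    and inv: "invertible (covariance_matrix M X)"
  obtains c where "0 < c" "\<And>z. c * (norm z)\<^sup>2 \<le> z \<bullet> (matrix_inv (covariance_matrix M X) *v z)"
proof -
  let ?C = "covariance_matrix M X"
  \<comment> \<open>\<open>T\<close> is one plus the trace of the covariance matrix, hence above its
    largest eigenvalue; the added 1 keeps it positive for the division.\<close>
  define T where "T = (\<Sum>i\<in>UNIV. LINT x|M. (X x $ i)\<^sup>2) + 1"
  have T: "T \<ge> 1" unfolding T_def by (simp add: sum_nonneg)
  have "(1 / T) * (norm z)\<^sup>2 \<le> z \<bullet> (matrix_inv ?C *v z)" for z
  proof -
    define w where "w = matrix_inv ?C *v z"
    have Cw: "?C *v w = z"
      by (simp add: w_def matrix_vector_mul_assoc matrix_inv_cancel[OF inv])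
    note bil = covariance_matrix_bilinear[OF assms(1,2)]
    have "0 \<le> (LINT x|M. (z \<bullet> X x - T * (w \<bullet> X x))\<^sup>2)" by simp
    also have "\<dots> = (LINT x|M. (z \<bullet> X x) * (z \<bullet> X x) - (2 * T) * ((z \<bullet> X x) * (w \<bullet> X x)) + T\<^sup>2 * ((w \<bullet> X x) * (w \<bullet> X x)))"
      by (simp add: power2_eq_square algebra_simps)
    also have "\<dots> = (LINT x|M. (z \<bullet> X x) * (z \<bullet> X x)) - (2 * T) * (norm z)\<^sup>2 + T\<^sup>2 * (z \<bullet> w)"
      using bil(1) by (simp add: bil(2) Cw power2_norm_eq_inner inner_commute)
    also have "(LINT x|M. (z \<bullet> X x) * (z \<bullet> X x)) \<le> (LINT x|M. (norm z)\<^sup>2 * (\<Sum>i\<in>UNIV. (X x $ i)\<^sup>2))"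
    proof (rule integral_mono)
      show "(z \<bullet> X x) * (z \<bullet> X x) \<le> (norm z)\<^sup>2 * (\<Sum>i\<in>UNIV. (X x $ i)\<^sup>2)" for x
        using Cauchy_Schwarz_ineq[of z "X x"]
        by (simp add: power2_eq_square power2_norm_eq_inner[unfolded power2_eq_square] inner_vec_def[of "X x" "X x"])
    qed (use int in \<open>auto intro!: bil(1) Bochner_Integration.integrable_sum simp: power2_eq_square\<close>)
    also have "\<dots> = (norm z)\<^sup>2 * (T - 1)"
      using int by (simp add: T_def power2_eq_square Bochner_Integration.integral_sum)
    also have "\<dots> \<le> (norm z)\<^sup>2 * T" by (intro mult_left_mono) auto
    finally have "T * (norm z)\<^sup>2 \<le> T * (T * (z \<bullet> w))"
      by (simp add: power2_eq_square algebra_simps)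
    then show ?thesis using T by (simp add: w_def field_simps)
  qed
  with that[of "1 / T"] T show thesis by auto
qed

subsection \<open>Centered Gaussian vectors\<close>

locale gaussian_vector = prob_space M + gaussian_weight "matrix_inv C" c K "gaussian_density C"
  for M :: "'a measure" and C :: "real^'n^'n" and c K :: real +
  fixes Z :: "'a \<Rightarrow> real^'n"
  assumes C_invertible: "invertible C"
    and Z: "distributed M lborel Z (\<lambda>z. ennreal (gaussian_density C z))"
begin

abbreviation "G \<equiv> matrix_inv C"

lemma Z_measurable[measurable]: "Z \<in> borel_measurable M"
  using distributed_measurable[OF Z] by simp

lemma integrable_Z:
  assumes "f \<in> borel_measurable borel"
  shows "integrable lborel (\<lambda>z. f z * gaussian_density C z) \<longleftrightarrow> integrable M (\<lambda>\<omega>. f (Z \<omega>))"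
  using distributed_integrable[OF Z, of f] assms g_nonneg by (simp add: mult.commute)

lemma integral_Z:
  assumes "f \<in> borel_measurable borel"
  shows "(LINT z|lborel. f z * gaussian_density C z) = (LINT \<omega>|M. f (Z \<omega>))"
  using distributed_integral[OF Z, of f] assms g_nonneg by (simp add: mult.commute)

lemma integration_by_parts_Z:
  assumes diff: "\<And>z. \<psi> differentiable (at z)"
    and cont: "continuous_on UNIV (\<lambda>z. gradient \<psi> z $ i)"
    and bound: "\<And>z. \<bar>\<psi> z\<bar> \<le> A * (1 + norm z)" "\<And>z. \<bar>gradient \<psi> z $ i\<bar> \<le> A"
  shows "integrable M (\<lambda>\<omega>. \<psi> (Z \<omega>) * (G *v Z \<omega>) $ i)"
    and "(LINT \<omega>|M. \<psi> (Z \<omega>) * (G *v Z \<omega>) $ i) = (LINT \<omega>|M. gradient \<psi> (Z \<omega>) $ i)"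
proof -
  have "continuous_on UNIV \<psi>"
    using diff by (auto intro!: continuous_at_imp_continuous_on differentiable_imp_continuous_within)
  then have [measurable]: "\<psi> \<in> borel_measurable borel" "(\<lambda>z. gradient \<psi> z $ i) \<in> borel_measurable borel"
    using cont by (auto intro: borel_measurable_continuous_onI)
  note ibp = integration_by_parts[OF assms]
  show "integrable M (\<lambda>\<omega>. \<psi> (Z \<omega>) * (G *v Z \<omega>) $ i)"
    using ibp(1) by (subst (asm) integrable_Z) auto
  show "(LINT \<omega>|M. \<psi> (Z \<omega>) * (G *v Z \<omega>) $ i) = (LINT \<omega>|M. gradient \<psi> (Z \<omega>) $ i)"
    using ibp(3) integral_Z[of "\<lambda>z. \<psi> z * (G *v z) $ i"] integral_Z[of "\<lambda>z. gradient \<psi> z $ i"] by simp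
qed

lemma Z_square_integrable: "integrable M (\<lambda>\<omega>. (norm (Z \<omega>))\<^sup>2)"
proof -
  have "integrable lborel (\<lambda>z. (norm z)\<^sup>2 * gaussian_density C z)"
    by (rule integrable_quadratic_growth[where B=1]) auto
  then show ?thesis by (subst (asm) integrable_Z) auto
qed

lemma Z_integrable: "integrable M Z" "integrable M (\<lambda>\<omega>. Z \<omega> $ i * Z \<omega> $ j)"
  by (rule square_integrable_components[OF Z_measurable Z_square_integrable])+

text \<open>The law of \<open>Z\<close> is known only through its density, so its moments are
  extracted from integration by parts: the constant function 1 gives E[G Z] = 0, and multiplying by
  \<open>C\<close> removes \<open>G\<close>.\<close>

lemma Z_centered: "integral\<^sup>L M Z = 0"
proof -
  have grad: "gradient (\<lambda>z::real^'n. 1) z = 0" for z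
    by (subst gradient_eqI[OF has_derivative_const]) (simp add: vec_eq_iff)
  have int: "integrable M (\<lambda>\<omega>. G *v Z \<omega>)"
    by (rule integrable_bounded_linear[OF matrix_vector_mul_bounded_linear Z_integrable(1)])
  have "(LINT \<omega>|M. (G *v Z \<omega>) $ i) = 0" for i
    using integration_by_parts_Z(2)[of "\<lambda>_. 1" i 1] by (simp add: grad)
  then have "(LINT \<omega>|M. G *v Z \<omega>) = 0"
    by (simp add: vec_eq_iff integral_vec_nth[OF int])
  then have "G *v integral\<^sup>L M Z = 0"
    by (simp add: integral_bounded_linear[OF matrix_vector_mul_bounded_linear Z_integrable(1)])
  then have "(C ** G) *v integral\<^sup>L M Z = 0"
    by (simp flip: matrix_vector_mul_assoc)
  then show ?thesis by (simp add: matrix_inv_cancel[OF C_invertible])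
qed

lemma GZ_Z:
  "integrable M (\<lambda>\<omega>. Z \<omega> $ j * (G *v Z \<omega>) $ i)"
  "(LINT \<omega>|M. Z \<omega> $ j * (G *v Z \<omega>) $ i) = (if i = j then 1 else 0)"
proof -
  have D: "((\<lambda>z::real^'n. z $ j) has_derivative (\<lambda>h. h $ j)) (at z)" for z
    by (auto intro: bounded_linear_imp_has_derivative bounded_linear_vec_nth)
  have grad: "gradient (\<lambda>z::real^'n. z $ j) z $ i = (if i = j then 1 else 0)" for z
    unfolding gradient_eqI[OF D] by (simp add: axis_def)
  have bound: "\<bar>z $ j\<bar> \<le> 1 * (1 + norm z)" for z :: "real^'n"
    using component_le_norm_cart[of z j] by simp
  have diff: "(\<lambda>z::real^'n. z $ j) differentiable (at z)" for z
    using D by (auto simp: differentiable_def)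
  note ibp = integration_by_parts_Z[of "\<lambda>z. z $ j" i 1, OF diff _ bound]
  show "integrable M (\<lambda>\<omega>. Z \<omega> $ j * (G *v Z \<omega>) $ i)"
    by (rule ibp(1)) (auto simp: grad)
  show "(LINT \<omega>|M. Z \<omega> $ j * (G *v Z \<omega>) $ i) = (if i = j then 1 else 0)"
    by (subst ibp(2)) (auto simp: grad prob_space)
qed

lemma Z_second_moment: "(LINT \<omega>|M. Z \<omega> $ k * Z \<omega> $ j) = C $ k $ j"
proof -
  \<comment> \<open>Writing Z = C (G Z) reduces the second moments to the correlation of
    \<open>Z\<close> with \<open>G Z\<close>.\<close>
  have "Z \<omega> = C *v (G *v Z \<omega>)" for \<omega>
    by (simp add: matrix_vector_mul_assoc matrix_inv_cancel[OF C_invertible])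
  then have "Z \<omega> $ k = (\<Sum>i\<in>UNIV. C $ k $ i * (G *v Z \<omega>) $ i)" for \<omega>
    by (metis (no_types) matrix_vector_mult_def vec_lambda_beta)
  then have "(LINT \<omega>|M. Z \<omega> $ k * Z \<omega> $ j) = (LINT \<omega>|M. (\<Sum>i\<in>UNIV. C $ k $ i * (Z \<omega> $ j * (G *v Z \<omega>) $ i)))"
    by (simp add: sum_distrib_left sum_distrib_right mult_ac)
  also have "\<dots> = (\<Sum>i\<in>UNIV. C $ k $ i * (if i = j then 1 else 0))"
    using GZ_Z by (subst Bochner_Integration.integral_sum) auto
  also have "\<dots> = (\<Sum>i\<in>UNIV. if i = j then C $ k $ i else 0)"
    by (intro sum.cong) auto
  finally show ?thesis by simp
qed

lemma test_function_integration_by_parts: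
  assumes \<phi>: "test_function \<phi>" and b: "b \<noteq> 0"
  shows "integrable M (\<lambda>\<omega>. \<phi> (b *\<^sub>R Z \<omega> + x) *\<^sub>R (G *v Z \<omega>))"
    and "integrable M (\<lambda>\<omega>. gradient \<phi> (b *\<^sub>R Z \<omega> + x))"
    and "(LINT \<omega>|M. \<phi> (b *\<^sub>R Z \<omega> + x) *\<^sub>R (G *v Z \<omega>)) = b *\<^sub>R (LINT \<omega>|M. gradient \<phi> (b *\<^sub>R Z \<omega> + x))"
proof -
  let ?\<psi> = "\<lambda>z. \<phi> (b *\<^sub>R z + x)"
  have \<psi>: "test_function ?\<psi>" by (rule test_function_affine[OF \<phi> b])
  obtain A where A: "A > 0" "\<And>x. \<bar>\<phi> x\<bar> \<le> A" "\<And>x. norm (gradient \<phi> x) \<le> A"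
    using test_function_bounded[OF \<phi>] by blast
  obtain B where B: "B > 0" "\<And>z. \<bar>?\<psi> z\<bar> \<le> B" "\<And>z. norm (gradient ?\<psi> z) \<le> B"
    using test_function_bounded[OF \<psi>] by blast
  have grad: "gradient ?\<psi> z = b *\<^sub>R gradient \<phi> (b *\<^sub>R z + x)" for z
    by (rule gradient_affine(2)[OF test_function_continuous(2)[OF \<phi>]])
  have bound: "\<bar>?\<psi> z\<bar> \<le> B * (1 + norm z)" for z
    using B(2)[of z] B(1) by (simp add: distrib_left add_increasing2)
  have bound': "\<bar>gradient ?\<psi> z $ i\<bar> \<le> B" for z i
    using B(3)[of z] component_le_norm_cart[of "gradient ?\<psi> z" i] by linarith
  note ibp = integration_by_parts_Z[OF test_function_continuous(2)[OF \<psi>] test_function_continuous(3)[OF \<psi>] bound bound']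
  show int1: "integrable M (\<lambda>\<omega>. \<phi> (b *\<^sub>R Z \<omega> + x) *\<^sub>R (G *v Z \<omega>))"
    using ibp(1) by (intro integrable_componentwise) simp
  have [measurable]: "gradient \<phi> \<in> borel_measurable borel"
    by (rule borel_measurable_continuous_onI[OF test_function_continuous(4)[OF \<phi>]])
  show int2: "integrable M (\<lambda>\<omega>. gradient \<phi> (b *\<^sub>R Z \<omega> + x))"
    by (rule integrable_const_bound[where B=A]) (use A(3) in auto)
  show "(LINT \<omega>|M. \<phi> (b *\<^sub>R Z \<omega> + x) *\<^sub>R (G *v Z \<omega>)) = b *\<^sub>R (LINT \<omega>|M. gradient \<phi> (b *\<^sub>R Z \<omega> + x))"
  proof (simp only: vec_eq_iff, intro allI)
    fix i
    have "(LINT \<omega>|M. \<phi> (b *\<^sub>R Z \<omega> + x) *\<^sub>R (G *v Z \<omega>)) $ i = (LINT \<omega>|M. \<phi> (b *\<^sub>R Z \<omega> + x) * (G *v Z \<omega>) $ i)"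
      by (simp add: integral_vec_nth[OF int1])
    also have "\<dots> = (LINT \<omega>|M. b * gradient \<phi> (b *\<^sub>R Z \<omega> + x) $ i)"
      using ibp(2)[of i] by (simp add: grad)
    also have "\<dots> = (b *\<^sub>R (LINT \<omega>|M. gradient \<phi> (b *\<^sub>R Z \<omega> + x))) $ i"
      by (simp add: integral_vec_nth[OF int2])
    finally show "(LINT \<omega>|M. \<phi> (b *\<^sub>R Z \<omega> + x) *\<^sub>R (G *v Z \<omega>)) $ i
        = (b *\<^sub>R (LINT \<omega>|M. gradient \<phi> (b *\<^sub>R Z \<omega> + x))) $ i" .
  qed
qed

text \<open>The Gaussian density is strictly positive everywhere, so null sets for the law of
  \<open>Z\<close> are Lebesgue null.\<close>

lemma AE_lborel_of_AE_Z:
  assumes "AE z in distr M borel Z. P z"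
  shows "AE z in lborel. P z"
proof -
  have "distr M borel Z = distr M lborel Z" by (rule distr_cong) auto
  also have "\<dots> = density lborel (\<lambda>z. ennreal (gaussian_density C z))"
    by (rule distributed_distr_eq_density[OF Z])
  finally have "AE z in density lborel (\<lambda>z. ennreal (gaussian_density C z)). P z"
    using assms by (simp only:)
  moreover have "(\<lambda>z. ennreal (gaussian_density C z)) \<in> borel_measurable lborel"
    using g_integrable by auto
  moreover have "0 < gaussian_density C z" for z
    using K_pos by (simp add: g_eq)
  ultimately show ?thesis by (simp add: AE_density)
qed

end

lemma (in prob_space) gaussian_vector_covariance:
  fixes X Z :: "'a \<Rightarrow> real^'n"
  assumes "integral\<^sup>L M X = 0" "\<And>i j. integrable M (\<lambda>\<omega>. X \<omega> $ i * X \<omega> $ j)"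
    and inv: "invertible (covariance_matrix M X)"
    and Z: "centered_gaussian M (covariance_matrix M X) Z"
  obtains c K where "gaussian_vector M (covariance_matrix M X) c K Z"
proof -
  let ?C = "covariance_matrix M X"
  let ?g = "gaussian_density ?C"
  define K where "K = sqrt ((2 * pi) ^ CARD('n) * det ?C)"
  have Z': "distributed M lborel Z (\<lambda>z. ennreal (?g z))"
    using Z by (simp add: centered_gaussian_def)
  have g: "?g z = exp (- (z \<bullet> (matrix_inv ?C *v z)) / 2) / K" for z
    by (simp add: gaussian_density_def K_def)
  have mass: "(\<integral>\<^sup>+z. ennreal (?g z) \<partial>lborel) = 1"
    using distributed_nn_integral[OF Z', of "\<lambda>_. 1"] by (simp add: emeasure_space_1)
  \<comment> \<open>The existence of \<open>Z\<close> settles the sign of the determinant: for K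
    \<le> 0 the quotient would be nonpositive everywhere (division by 0 gives 0),
    \<open>ennreal\<close> would turn it into 0, and the total mass could not be 1.\<close>
  have "0 < K"
  proof (rule ccontr)
    assume "\<not> 0 < K"
    then have "ennreal (?g z) = 0" for z
      by (intro ennreal_neg) (simp add: g divide_nonneg_nonpos)
    with mass show False by simp
  qed
  moreover have "integrable lborel ?g"
  proof (rule integrableI_nonneg)
    show "?g \<in> borel_measurable lborel"
      unfolding g[abs_def] by measurable
    show "AE z in lborel. 0 \<le> ?g z" using \<open>0 < K\<close> by (simp add: g)
    show "(\<integral>\<^sup>+z. ennreal (?g z) \<partial>lborel) < \<infinity>" by (simp add: mass)
  qed
  moreover obtain c where "0 < c" "\<And>z. c * (norm z)\<^sup>2 \<le> z \<bullet> (matrix_inv ?C *v z)"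
    using covariance_matrix_inverse_coercive[OF assms(1-3)] by blast
  moreover have "transpose (matrix_inv ?C) = matrix_inv ?C"
    by (rule transpose_matrix_inv[OF inv covariance_matrix_symmetric[OF assms(1,2)]])
  ultimately have "gaussian_vector M ?C c K Z"
    using inv Z' g by unfold_locales auto
  then show thesis by (rule that)
qed

text \<open>A proper subspace has smaller dimension and is therefore Lebesgue null; it cannot carry
  almost every point.\<close>

lemma AE_subspace_imp_UNIV:
  fixes S :: "'a::euclidean_space set"
  assumes S: "subspace S" and AE: "AE z in lborel. z \<in> S"
  shows "S = UNIV"
proof (rule ccontr)
  assume "S \<noteq> UNIV"
  then have "dim S < DIM('a)"
    using S dim_subset_UNIV[of S] by (metis dim_eq_full le_neq_implies_less span_eq_iff)
  then have "S \<in> null_sets lebesgue"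
    by (metis negligible_lowdim negligible_iff_null_sets)
  then have "AE z in lebesgue. z \<notin> S"
    by (rule AE_not_in)
  moreover have "AE z in lebesgue. z \<in> S"
    using AE by (rule AE_completion)
  ultimately have "AE z in (lebesgue :: 'a measure). False"
    by eventually_elim simp
  then have "UNIV \<in> null_sets (lebesgue :: 'a measure)"
    by (simp add: AE_iff_null_sets[of UNIV])
  then show False by (simp add: null_sets_def)
qed

subsection \<open>Scores and conditional expectations\<close>

text \<open>Independence makes the joint law a product, so Fubini applies. Both orders are used:
  \<open>Z\<close> is integrated first for Gaussian integration by parts, \<open>X\<close> first for
  the Stein identity.\<close>

lemma (in prob_space) indep_var_iterated_integral:
  fixes F :: "'b \<times> 'b \<Rightarrow> 'd::{banach, second_countable_topology}"
  assumes indep: "indep_var S X T Z"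
    and F[measurable]: "F \<in> borel_measurable (S \<Otimes>\<^sub>M T)"
    and int: "integrable M (\<lambda>\<omega>. F (X \<omega>, Z \<omega>))"
  shows "(LINT \<omega>|M. F (X \<omega>, Z \<omega>)) = (LINT \<omega>|M. LINT \<omega>'|M. F (X \<omega>, Z \<omega>'))"
    and "(LINT \<omega>|M. F (X \<omega>, Z \<omega>)) = (LINT \<omega>'|M. LINT \<omega>|M. F (X \<omega>, Z \<omega>'))"
proof -
  have [measurable]: "X \<in> measurable M S" "Z \<in> measurable M T"
    and law: "distr M S X \<Otimes>\<^sub>M distr M T Z = distr M (S \<Otimes>\<^sub>M T) (\<lambda>\<omega>. (X \<omega>, Z \<omega>))"
    using indep by (auto simp: indep_var_distribution_eq)
  interpret X: prob_space "distr M S X" by (rule prob_space_distr) simp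
  interpret Z: prob_space "distr M T Z" by (rule prob_space_distr) simp
  interpret XZ: pair_prob_space "distr M S X" "distr M T Z" ..
  have int': "integrable (distr M S X \<Otimes>\<^sub>M distr M T Z) F"
    unfolding law using int by (simp add: integrable_distr_eq)
  have "(LINT \<omega>|M. F (X \<omega>, Z \<omega>)) = integral\<^sup>L (distr M S X \<Otimes>\<^sub>M distr M T Z) F"
    unfolding law by (simp add: integral_distr)
  also have "\<dots> = (LINT x|distr M S X. LINT z|distr M T Z. F (x, z))"
    using XZ.integral_fst'[OF int'] by simp
  also have "\<dots> = (LINT x|distr M S X. LINT \<omega>'|M. F (x, Z \<omega>'))"
    by (intro Bochner_Integration.integral_cong refl integral_distr) auto
  also have "\<dots> = (LINT \<omega>|M. LINT \<omega>'|M. F (X \<omega>, Z \<omega>'))"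
    by (rule integral_distr) auto
  finally show first: "(LINT \<omega>|M. F (X \<omega>, Z \<omega>)) = (LINT \<omega>|M. LINT \<omega>'|M. F (X \<omega>, Z \<omega>'))" .
  have "(LINT \<omega>|M. F (X \<omega>, Z \<omega>)) = integral\<^sup>L (distr M S X \<Otimes>\<^sub>M distr M T Z) F"
    unfolding law by (simp add: integral_distr)
  also have "\<dots> = (LINT z|distr M T Z. LINT x|distr M S X. F (x, z))"
    using XZ.integral_snd[of "\<lambda>x z. F (x, z)"] int' by simp
  also have "\<dots> = (LINT z|distr M T Z. LINT \<omega>|M. F (X \<omega>, z))"
    by (intro Bochner_Integration.integral_cong refl integral_distr) auto
  also have "\<dots> = (LINT \<omega>'|M. LINT \<omega>|M. F (X \<omega>, Z \<omega>'))"
    by (rule integral_distr) auto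
  finally show "(LINT \<omega>|M. F (X \<omega>, Z \<omega>)) = (LINT \<omega>'|M. LINT \<omega>|M. F (X \<omega>, Z \<omega>'))" .
qed

text \<open>Under the law of \<open>V\<close>, each component of the difference integrates to zero
  against every test function. This transfers what is known of a constructed score to an arbitrary
  one.\<close>

lemma (in prob_space) score_unique:
  assumes V[measurable]: "V \<in> borel_measurable M"
    and \<rho>: "is_score M V \<rho>" and \<rho>': "is_score M V \<rho>'"
  shows "AE \<omega> in M. \<rho> (V \<omega>) = \<rho>' (V \<omega>)"
proof -
  have [measurable]: "\<rho> \<in> borel_measurable borel" "\<rho>' \<in> borel_measurable borel"
    using \<rho> \<rho>' by (auto simp: is_score_def)
  interpret D: prob_space "distr M borel V" by (rule prob_space_distr) simp
  have "AE \<omega> in M. \<rho> (V \<omega>) $ i - \<rho>' (V \<omega>) $ i = 0" for i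
  proof -
    have "AE y in distr M borel V. \<rho> y $ i - \<rho>' y $ i = 0"
    proof (rule AE_zero_if_test_integrals_zero)
      fix \<phi> :: "real^'b \<Rightarrow> real" assume \<phi>: "test_function \<phi>"
      have [measurable]: "\<phi> \<in> borel_measurable borel"
        by (rule borel_measurable_continuous_onI[OF test_function_continuous(1)[OF \<phi>]])
      have int: "integrable M (\<lambda>\<omega>. \<phi> (V \<omega>) *\<^sub>R \<rho> (V \<omega>))" "integrable M (\<lambda>\<omega>. \<phi> (V \<omega>) *\<^sub>R \<rho>' (V \<omega>))"
        and eq: "(LINT \<omega>|M. \<phi> (V \<omega>) *\<^sub>R \<rho> (V \<omega>)) = (LINT \<omega>|M. \<phi> (V \<omega>) *\<^sub>R \<rho>' (V \<omega>))"
        using \<rho> \<rho>' \<phi> by (auto simp: is_score_def)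
      note int' = integrable_vec_nth[OF int(1), of i] integrable_vec_nth[OF int(2), of i]
      show "integrable (distr M borel V) (\<lambda>y. \<phi> y * (\<rho> y $ i - \<rho>' y $ i))"
        using int' by (simp add: integrable_distr_eq right_diff_distrib)
      show "(LINT y|distr M borel V. \<phi> y * (\<rho> y $ i - \<rho>' y $ i)) = 0"
        using int' eq integral_vec_nth[OF int(1), of i] integral_vec_nth[OF int(2), of i]
        by (simp add: integral_distr right_diff_distrib)
    qed (auto intro: D.sigma_finite_measure_axioms)
    then show ?thesis by (subst (asm) AE_distr_iff) auto
  qed
  then have "AE \<omega> in M. \<forall>i. \<rho> (V \<omega>) $ i - \<rho>' (V \<omega>) $ i = 0"
    by (simp add: AE_all_countable)
  then show ?thesis by (rule eventually_mono) (simp add: vec_eq_iff)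
qed

lemma (in prob_space) subalgebra_vimage_algebra:
  assumes "V \<in> measurable M N"
  shows "finite_measure_subalgebra M (vimage_algebra (space M) V N)"
proof (unfold_locales)
  show "subalgebra M (vimage_algebra (space M) V N)"
    using assms measurable_sets[OF assms]
    by (auto simp: subalgebra_def sets_vimage_algebra2 measurable_space)
qed

lemma (in prob_space) cond_exp_vec_factor:
  fixes V S :: "'a \<Rightarrow> real^'n"
  assumes V[measurable]: "V \<in> borel_measurable M"
  obtains w where "w \<in> borel_measurable borel" "\<And>\<omega>. \<omega> \<in> space M \<Longrightarrow> cond_exp_vec M V S \<omega> = w (V \<omega>)"
proof -
  have "\<exists>w. w \<in> borel_measurable borel \<and> (\<forall>\<omega>\<in>space M. cond_exp_vec M V S \<omega> $ i = w (V \<omega>))" for i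
  proof -
    have "(\<lambda>\<omega>. cond_exp_vec M V S \<omega> $ i) \<in> borel_measurable (vimage_algebra (space M) V borel)"
      by (simp add: cond_exp_vec_def)
    then show ?thesis
      by (rule borel_measurable_vimage_algebra_factor[rotated]) auto
  qed
  then obtain w where w: "\<And>i. w i \<in> borel_measurable borel"
      "\<And>i \<omega>. \<omega> \<in> space M \<Longrightarrow> cond_exp_vec M V S \<omega> $ i = w i (V \<omega>)"
    by metis
  show thesis
  proof
    show "(\<lambda>y. \<chi> i. w i y) \<in> borel_measurable borel"
      by (rule borel_measurable_componentwise) (simp add: w)
    show "cond_exp_vec M V S \<omega> = (\<chi> i. w i (V \<omega>))" if "\<omega> \<in> space M" for \<omega>
      using w(2)[OF that] by (simp add: vec_eq_iff)
  qed
qed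

text \<open>Integrability is asked of the product, so the weight may be unbounded; later it is a
  coordinate of \<open>Xt\<close>.\<close>

lemma (in prob_space) cond_exp_vec_mult:
  fixes V S :: "'a \<Rightarrow> real^'n"
  assumes V[measurable]: "V \<in> borel_measurable M" and [measurable]: "S \<in> borel_measurable M"
    and a: "a \<in> borel_measurable borel" and int: "integrable M (\<lambda>\<omega>. a (V \<omega>) * S \<omega> $ i)"
  shows "integrable M (\<lambda>\<omega>. a (V \<omega>) * cond_exp_vec M V S \<omega> $ i)"
    "(LINT \<omega>|M. a (V \<omega>) * cond_exp_vec M V S \<omega> $ i) = (LINT \<omega>|M. a (V \<omega>) * S \<omega> $ i)"
proof -
  interpret F: finite_measure_subalgebra M "vimage_algebra (space M) V borel"
    by (rule subalgebra_vimage_algebra[OF V])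
  have V': "V \<in> borel_measurable (vimage_algebra (space M) V borel)"
    by (rule measurable_vimage_algebra1) simp
  note intg = F.real_cond_exp_intg[OF int measurable_compose[OF V' a]]
  show "integrable M (\<lambda>\<omega>. a (V \<omega>) * cond_exp_vec M V S \<omega> $ i)"
    "(LINT \<omega>|M. a (V \<omega>) * cond_exp_vec M V S \<omega> $ i) = (LINT \<omega>|M. a (V \<omega>) * S \<omega> $ i)"
    using intg by (auto simp: cond_exp_vec_def)
qed

lemma (in prob_space) cond_exp_vec_scaleR:
  fixes V S :: "'a \<Rightarrow> real^'n"
  assumes V: "V \<in> borel_measurable M" and S: "integrable M S"
    and a: "a \<in> borel_measurable borel" and bound: "\<And>y. \<bar>a y\<bar> \<le> B"
  shows "integrable M (\<lambda>\<omega>. a (V \<omega>) *\<^sub>R cond_exp_vec M V S \<omega>)"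
    "(LINT \<omega>|M. a (V \<omega>) *\<^sub>R cond_exp_vec M V S \<omega>) = (LINT \<omega>|M. a (V \<omega>) *\<^sub>R S \<omega>)"
proof -
  have int: "integrable M (\<lambda>\<omega>. a (V \<omega>) *\<^sub>R S \<omega>)"
    by (rule integrable_bounded_scaleR[OF S measurable_compose[OF V a] bound])
  have S': "S \<in> borel_measurable M" using S by auto
  note ce = cond_exp_vec_mult[OF V S' a, of i for i]
  have comp: "integrable M (\<lambda>\<omega>. a (V \<omega>) * S \<omega> $ i)" for i
    using integrable_vec_nth[OF int, of i] by simp
  show int': "integrable M (\<lambda>\<omega>. a (V \<omega>) *\<^sub>R cond_exp_vec M V S \<omega>)"
    by (rule integrable_componentwise) (simp add: ce(1)[OF comp])
  show "(LINT \<omega>|M. a (V \<omega>) *\<^sub>R cond_exp_vec M V S \<omega>) = (LINT \<omega>|M. a (V \<omega>) *\<^sub>R S \<omega>)"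
    by (simp add: vec_eq_iff integral_vec_nth[OF int] integral_vec_nth[OF int'] ce(2)[OF comp])
qed

text \<open>Conditional Jensen inequality for the square function.\<close>

lemma (in prob_space) cond_exp_vec_square_integrable:
  fixes V S :: "'a \<Rightarrow> real^'n"
  assumes V: "V \<in> borel_measurable M" and "integrable M (\<lambda>\<omega>. S \<omega> $ i)" "integrable M (\<lambda>\<omega>. (S \<omega> $ i)\<^sup>2)"
  shows "integrable M (\<lambda>\<omega>. (cond_exp_vec M V S \<omega> $ i)\<^sup>2)"
proof -
  interpret F: finite_measure_subalgebra M "vimage_algebra (space M) V borel"
    by (rule subalgebra_vimage_algebra[OF V])
  have "convex_on UNIV (\<lambda>x::real. x\<^sup>2)"
    by (rule convex_power_even) simp
  then show ?thesis
    unfolding cond_exp_vec_def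
    using F.integrable_convex_cond_exp[OF assms(2), of UNIV _ _ "\<lambda>x. x\<^sup>2"] assms(3)
    by (simp add: emeasure_space_1)
qed

subsection \<open>Smoothing by an independent Gaussian vector\<close>

text \<open>\<open>Y_integrable\<close> gives the conditional expectation of \<open>Y\<close> its
  usual meaning. It is also the source of the global integrability of
  \<open>\<tau> (X \<omega>)\<close>, which \<open>stein\<close> controls only against gradients of
  test functions.\<close>

locale gaussian_smoothing = gaussian_vector M C c K Z
  for M :: "'a measure" and C :: "real^'n^'n" and c K :: real and Z :: "'a \<Rightarrow> real^'n" +
  fixes X :: "'a \<Rightarrow> real^'n" and \<tau> :: "real^'n \<Rightarrow> real^'n^'n" and t :: real
  assumes X[measurable]: "X \<in> borel_measurable M"
    and X_square_integrable: "integrable M (\<lambda>\<omega>. (norm (X \<omega>))\<^sup>2)"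
    and X_centered: "integral\<^sup>L M X = 0"
    and C_eq: "C = covariance_matrix M X"
    and stein: "is_stein_matrix M X \<tau>"
    and indep: "indep_var borel X borel Z"
    and t: "0 < t" "t < 1"
    and Y_integrable: "integrable M (\<lambda>\<omega>. (mat 1 - matrix_inv C ** \<tau> (X \<omega>)) *v (matrix_inv C *v Z \<omega>))"
begin

definition "Xt \<omega> = sqrt t *\<^sub>R X \<omega> + sqrt (1 - t) *\<^sub>R Z \<omega>"

definition "Y \<omega> = (mat 1 - G ** \<tau> (X \<omega>)) *v (G *v Z \<omega>)"

lemma Xt_measurable[measurable]: "Xt \<in> borel_measurable M"
  unfolding Xt_def by measurable

lemma \<tau>_measurable[measurable]: "\<tau> \<in> borel_measurable borel"
  using stein by (simp add: is_stein_matrix_def)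

lemma X_integrable: "integrable M X" "integrable M (\<lambda>\<omega>. X \<omega> $ i * X \<omega> $ j)"
  by (rule square_integrable_components[OF X X_square_integrable])+

lemma GZ_integrable: "integrable M (\<lambda>\<omega>. G *v Z \<omega>)"
  by (rule integrable_bounded_linear[OF matrix_vector_mul_bounded_linear Z_integrable(1)])

lemma C_G: "C *v (G *v v) = v" "G *v (C *v v) = v"
  by (simp_all add: matrix_vector_mul_assoc matrix_inv_cancel[OF C_invertible])

lemma Y_eq: "Y \<omega> = G *v Z \<omega> - G *v (\<tau> (X \<omega>) *v (G *v Z \<omega>))"
  by (simp add: Y_def matrix_vector_mult_diff_rdistrib flip: matrix_vector_mul_assoc)

lemma \<tau>GZ_integrable: "integrable M (\<lambda>\<omega>. \<tau> (X \<omega>) *v (G *v Z \<omega>))"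
proof -
  \<comment> \<open>Solving the formula for \<open>Y\<close> gives Z - C Y = \<tau>(X) G Z.\<close>
  have "integrable M (\<lambda>\<omega>. Z \<omega> - C *v Y \<omega>)"
    using Y_integrable
    by (intro Bochner_Integration.integrable_diff Z_integrable
        integrable_bounded_linear[OF matrix_vector_mul_bounded_linear]) (simp add: Y_def)
  then show ?thesis by (simp add: Y_eq matrix_vector_mult_diff_distrib C_G)
qed

text \<open>By Fubini, \<open>\<tau>(X) G z\<close> is integrable for almost every \<open>z\<close>; as these \<open>z\<close> form a linear
  subspace, it is integrable for every \<open>z\<close>.\<close>

lemma \<tau>X_integrable: "integrable M (\<lambda>\<omega>. \<tau> (X \<omega>))"
proof -
  let ?S = "{z. integrable M (\<lambda>\<omega>. \<tau> (X \<omega>) *v (G *v z))}"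
  have law: "distr M borel X \<Otimes>\<^sub>M distr M borel Z = distr M (borel \<Otimes>\<^sub>M borel) (\<lambda>\<omega>. (X \<omega>, Z \<omega>))"
    using indep by (simp add: indep_var_distribution_eq)
  interpret X: prob_space "distr M borel X" by (rule prob_space_distr) simp
  interpret Z: prob_space "distr M borel Z" by (rule prob_space_distr) simp
  interpret ZX: pair_prob_space "distr M borel Z" "distr M borel X" ..
  interpret XZ: pair_prob_space "distr M borel X" "distr M borel Z" ..
  have "integrable (distr M borel X \<Otimes>\<^sub>M distr M borel Z) (\<lambda>(x, z). \<tau> x *v (G *v z))"
    unfolding law using \<tau>GZ_integrable by (simp add: integrable_distr_eq)
  from ZX.AE_integrable_fst'[OF XZ.integrable_product_swap[OF this]]
  have "AE z in distr M borel Z. z \<in> ?S"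
    by (simp add: integrable_distr_eq)
  then have "AE z in lborel. z \<in> ?S"
    by (rule AE_lborel_of_AE_Z)
  moreover have "subspace ?S"
    by (auto simp: subspace_def matrix_vector_right_distrib matrix_vector_mult_scaleR)
  ultimately have S: "?S = UNIV"
    by (rule AE_subspace_imp_UNIV[rotated])
  \<comment> \<open>Taking z = C v makes G z = v arbitrary; basis vectors then yield the entries of
    the matrix.\<close>
  have col: "integrable M (\<lambda>\<omega>. \<tau> (X \<omega>) *v v)" for v
    using S[THEN equalityD2, THEN subsetD, of "C *v v"] by (simp add: C_G)
  have "integrable M (\<lambda>\<omega>. \<tau> (X \<omega>) $ i $ j)" for i j
    using integrable_vec_nth[OF col[of "axis j 1"], of i]
    by (simp add: matrix_vector_mul_component inner_axis)
  then show ?thesis by (intro integrable_componentwise)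
qed

section \<open>Integral identities for a fixed test function\<close>

context
  fixes \<phi> :: "real^'n \<Rightarrow> real"
  assumes \<phi>: "test_function \<phi>"
begin

lemma test_function_measurable[measurable]:
  "\<phi> \<in> borel_measurable borel" "gradient \<phi> \<in> borel_measurable borel"
  using test_function_continuous(1,4)[OF \<phi>] by (auto intro: borel_measurable_continuous_onI)

lemma integrable_test_scaleR:
  fixes S :: "'a \<Rightarrow> real^'n"
  assumes "integrable M S"
  shows "integrable M (\<lambda>\<omega>. \<phi> (Xt \<omega>) *\<^sub>R S \<omega>)"
proof -
  obtain B where B: "0 < B" "\<And>x. \<bar>\<phi> x\<bar> \<le> B" "\<And>x. norm (gradient \<phi> x) \<le> B"
    using test_function_bounded[OF \<phi>] by metis
  show ?thesis by (rule integrable_bounded_scaleR[OF assms _ B(2)]) measurable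
qed

lemma integrable_gradient:
  fixes A :: "'a \<Rightarrow> real^'n^'n"
  assumes "integrable M A"
  shows "integrable M (\<lambda>\<omega>. A \<omega> *v gradient \<phi> (Xt \<omega>))"
proof -
  obtain B where B: "0 < B" "\<And>x. \<bar>\<phi> x\<bar> \<le> B" "\<And>x. norm (gradient \<phi> x) \<le> B"
    using test_function_bounded[OF \<phi>] by metis
  show ?thesis by (rule integrable_bounded_matrix_vector[OF assms _ B(3)]) measurable
qed

text \<open>For frozen X = x the matrix A(x) is constant and can be pulled out of the integral over
  \<open>Z\<close>, where the Gaussian identity applies. It is left general because both the
  identity matrix and \<tau> will be inserted.\<close>

lemma smoothed_integration_by_parts:
  fixes A :: "real^'n \<Rightarrow> real^'n^'n"
  assumes [measurable]: "A \<in> borel_measurable borel"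
    and A: "integrable M (\<lambda>\<omega>. A (X \<omega>))" and AGZ: "integrable M (\<lambda>\<omega>. A (X \<omega>) *v (G *v Z \<omega>))"
  shows "(LINT \<omega>|M. \<phi> (Xt \<omega>) *\<^sub>R (A (X \<omega>) *v (G *v Z \<omega>)))
    = sqrt (1 - t) *\<^sub>R (LINT \<omega>|M. A (X \<omega>) *v gradient \<phi> (Xt \<omega>))"
proof -
  let ?arg = "\<lambda>x z. sqrt t *\<^sub>R x + sqrt (1 - t) *\<^sub>R z"
  have swap: "?arg x z = sqrt (1 - t) *\<^sub>R z + sqrt t *\<^sub>R x" for x z :: "real^'n" by simp
  have b: "sqrt (1 - t) \<noteq> 0" using t by simp
  note ibp = test_function_integration_by_parts[OF \<phi> b]
  note mv = integral_bounded_linear[OF matrix_vector_mul_bounded_linear, symmetric]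
  have inner: "(LINT \<omega>'|M. \<phi> (?arg x (Z \<omega>')) *\<^sub>R (A x *v (G *v Z \<omega>')))
      = sqrt (1 - t) *\<^sub>R (LINT \<omega>'|M. A x *v gradient \<phi> (?arg x (Z \<omega>')))" for x
  proof -
    have "(LINT \<omega>'|M. \<phi> (?arg x (Z \<omega>')) *\<^sub>R (A x *v (G *v Z \<omega>')))
        = A x *v (LINT \<omega>'|M. \<phi> (?arg x (Z \<omega>')) *\<^sub>R (G *v Z \<omega>'))"
      unfolding swap mv[OF ibp(1)] by (simp add: matrix_vector_mult_scaleR)
    also have "\<dots> = sqrt (1 - t) *\<^sub>R (LINT \<omega>'|M. A x *v gradient \<phi> (?arg x (Z \<omega>')))"
      unfolding swap ibp(3) mv[OF ibp(2), symmetric] by (simp add: matrix_vector_mult_scaleR)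
    finally show ?thesis .
  qed
  have "(LINT \<omega>|M. \<phi> (Xt \<omega>) *\<^sub>R (A (X \<omega>) *v (G *v Z \<omega>)))
      = (LINT \<omega>|M. LINT \<omega>'|M. \<phi> (?arg (X \<omega>) (Z \<omega>')) *\<^sub>R (A (X \<omega>) *v (G *v Z \<omega>')))"
    using indep_var_iterated_integral(1)[OF indep, of "\<lambda>(x, z). \<phi> (?arg x z) *\<^sub>R (A x *v (G *v z))"]
      integrable_test_scaleR[OF AGZ] by (simp add: Xt_def)
  also have "\<dots> = sqrt (1 - t) *\<^sub>R (LINT \<omega>|M. LINT \<omega>'|M. A (X \<omega>) *v gradient \<phi> (?arg (X \<omega>) (Z \<omega>')))"
    by (simp add: inner)
  also have "(LINT \<omega>|M. LINT \<omega>'|M. A (X \<omega>) *v gradient \<phi> (?arg (X \<omega>) (Z \<omega>')))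
      = (LINT \<omega>|M. A (X \<omega>) *v gradient \<phi> (Xt \<omega>))"
    using indep_var_iterated_integral(1)[OF indep, of "\<lambda>(x, z). A x *v gradient \<phi> (?arg x z)"]
      integrable_gradient[OF A] by (simp add: Xt_def)
  finally show ?thesis .
qed

text \<open>For frozen Z = z the Stein identity applies to x \<mapsto> \<phi>(sqrt t x + sqrt (1 -
  t) z), whose gradient carries the factor sqrt t. Integrating over z by Fubini is where the
  integrability of \<open>\<tau> (X \<omega>)\<close> enters.\<close>

lemma smoothed_stein_identity:
  "sqrt t *\<^sub>R (LINT \<omega>|M. \<tau> (X \<omega>) *v gradient \<phi> (Xt \<omega>)) = (LINT \<omega>|M. \<phi> (Xt \<omega>) *\<^sub>R X \<omega>)"
proof -
  let ?arg = "\<lambda>x z. sqrt t *\<^sub>R x + sqrt (1 - t) *\<^sub>R z"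
  have inner: "sqrt t *\<^sub>R (LINT \<omega>|M. \<tau> (X \<omega>) *v gradient \<phi> (?arg (X \<omega>) z)) = (LINT \<omega>|M. \<phi> (?arg (X \<omega>) z) *\<^sub>R X \<omega>)" for z
  proof -
    let ?\<psi> = "\<lambda>x. \<phi> (?arg x z)"
    have "test_function ?\<psi>" using t by (intro test_function_affine[OF \<phi>]) simp
    then have "(LINT \<omega>|M. \<tau> (X \<omega>) *v gradient ?\<psi> (X \<omega>)) = (LINT \<omega>|M. ?\<psi> (X \<omega>) *\<^sub>R X \<omega>)"
      using stein by (simp add: is_stein_matrix_def)
    moreover have "gradient ?\<psi> x = sqrt t *\<^sub>R gradient \<phi> (?arg x z)" for x
      by (rule gradient_affine(2)[OF test_function_continuous(2)[OF \<phi>]])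
    ultimately show ?thesis by (simp add: matrix_vector_mult_scaleR)
  qed
  have "(LINT \<omega>|M. \<tau> (X \<omega>) *v gradient \<phi> (Xt \<omega>))
      = (LINT \<omega>'|M. LINT \<omega>|M. \<tau> (X \<omega>) *v gradient \<phi> (?arg (X \<omega>) (Z \<omega>')))"
    using indep_var_iterated_integral(2)[OF indep, of "\<lambda>(x, z). \<tau> x *v gradient \<phi> (?arg x z)"]
      integrable_gradient[OF \<tau>X_integrable] by (simp add: Xt_def)
  then have "sqrt t *\<^sub>R (LINT \<omega>|M. \<tau> (X \<omega>) *v gradient \<phi> (Xt \<omega>))
      = (LINT \<omega>'|M. sqrt t *\<^sub>R (LINT \<omega>|M. \<tau> (X \<omega>) *v gradient \<phi> (?arg (X \<omega>) (Z \<omega>'))))"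
    by simp
  also have "\<dots> = (LINT \<omega>'|M. LINT \<omega>|M. \<phi> (?arg (X \<omega>) (Z \<omega>')) *\<^sub>R X \<omega>)"
    by (simp only: inner)
  also have "\<dots> = (LINT \<omega>|M. \<phi> (Xt \<omega>) *\<^sub>R X \<omega>)"
    using indep_var_iterated_integral(2)[OF indep, of "\<lambda>(x, z). \<phi> (?arg x z) *\<^sub>R x"]
      integrable_test_scaleR[OF X_integrable(1)] by (simp add: Xt_def)
  finally show ?thesis .
qed

lemma test_GZ: "(LINT \<omega>|M. \<phi> (Xt \<omega>) *\<^sub>R (G *v Z \<omega>)) = sqrt (1 - t) *\<^sub>R (LINT \<omega>|M. gradient \<phi> (Xt \<omega>))"
proof -
  have "integrable M (\<lambda>\<omega>. mat 1 *v (G *v Z \<omega>))" using GZ_integrable by (simp only: matrix_vector_mul_lid)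
  from smoothed_integration_by_parts[OF borel_measurable_const integrable_const this]
  show ?thesis by (simp only: matrix_vector_mul_lid)
qed

text \<open>The factor sqrt t is kept on the left because the Stein identity eliminates \<tau> only
  in the combination sqrt t E[\<tau>(X) \<nabla>\<phi>(Xt)]; no division is then required.\<close>

lemma test_Y:
  "sqrt t *\<^sub>R (LINT \<omega>|M. \<phi> (Xt \<omega>) *\<^sub>R Y \<omega>)
     = (sqrt t * sqrt (1 - t)) *\<^sub>R (LINT \<omega>|M. gradient \<phi> (Xt \<omega>))
       - sqrt (1 - t) *\<^sub>R (G *v (LINT \<omega>|M. \<phi> (Xt \<omega>) *\<^sub>R X \<omega>))"
proof -
  have int: "integrable M (\<lambda>\<omega>. \<phi> (Xt \<omega>) *\<^sub>R (\<tau> (X \<omega>) *v (G *v Z \<omega>)))"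
    by (rule integrable_test_scaleR[OF \<tau>GZ_integrable])
  have "\<phi> (Xt \<omega>) *\<^sub>R Y \<omega> = \<phi> (Xt \<omega>) *\<^sub>R (G *v Z \<omega>) - G *v (\<phi> (Xt \<omega>) *\<^sub>R (\<tau> (X \<omega>) *v (G *v Z \<omega>)))" for \<omega>
    by (simp add: Y_eq scaleR_diff_right matrix_vector_mult_scaleR)
  then have "(LINT \<omega>|M. \<phi> (Xt \<omega>) *\<^sub>R Y \<omega>) = (LINT \<omega>|M. \<phi> (Xt \<omega>) *\<^sub>R (G *v Z \<omega>))
      - G *v (LINT \<omega>|M. \<phi> (Xt \<omega>) *\<^sub>R (\<tau> (X \<omega>) *v (G *v Z \<omega>)))"
    by (simp only: Bochner_Integration.integral_diff[OF integrable_test_scaleR[OF GZ_integrable]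
          integrable_bounded_linear[OF matrix_vector_mul_bounded_linear int]]
        integral_bounded_linear[OF matrix_vector_mul_bounded_linear int])
  also have "\<dots> = sqrt (1 - t) *\<^sub>R (LINT \<omega>|M. gradient \<phi> (Xt \<omega>))
      - G *v (sqrt (1 - t) *\<^sub>R (LINT \<omega>|M. \<tau> (X \<omega>) *v gradient \<phi> (Xt \<omega>)))"
    by (simp add: test_GZ smoothed_integration_by_parts[OF \<tau>_measurable \<tau>X_integrable \<tau>GZ_integrable])
  finally show ?thesis
    by (simp add: scaleR_diff_right matrix_vector_mult_scaleR mult.commute flip: smoothed_stein_identity)
qed

end

section \<open>The two representations of the score\<close>

lemma ex_score_GZ:
  obtains \<rho> where "is_score M Xt \<rho>"
    "\<And>\<omega>. \<omega> \<in> space M \<Longrightarrow> \<rho> (Xt \<omega>) = - (1 / sqrt (1 - t)) *\<^sub>R cond_exp_vec M Xt (\<lambda>\<omega>. G *v Z \<omega>) \<omega>"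
proof -
  let ?E = "cond_exp_vec M Xt (\<lambda>\<omega>. G *v Z \<omega>)"
  obtain w where [measurable]: "w \<in> borel_measurable borel" and w: "\<And>\<omega>. \<omega> \<in> space M \<Longrightarrow> ?E \<omega> = w (Xt \<omega>)"
    using cond_exp_vec_factor[OF Xt_measurable] by blast
  let ?\<rho> = "\<lambda>y. - (1 / sqrt (1 - t)) *\<^sub>R w y"
  have "is_score M Xt ?\<rho>"
    unfolding is_score_def
  proof (intro conjI allI impI)
    fix \<phi> :: "real^'n \<Rightarrow> real" assume \<phi>: "test_function \<phi>"
    obtain B where B: "0 < B" "\<And>x. \<bar>\<phi> x\<bar> \<le> B" "\<And>x. norm (gradient \<phi> x) \<le> B"
      using test_function_bounded[OF \<phi>] by metis
    note ce = cond_exp_vec_scaleR[OF Xt_measurable GZ_integrable test_function_measurable(1)[OF \<phi>] B(2)]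
    have eq: "\<phi> (Xt \<omega>) *\<^sub>R ?\<rho> (Xt \<omega>) = - (1 / sqrt (1 - t)) *\<^sub>R (\<phi> (Xt \<omega>) *\<^sub>R ?E \<omega>)" if "\<omega> \<in> space M" for \<omega>
      by (simp add: w[OF that])
    have "integrable M (\<lambda>\<omega>. - (1 / sqrt (1 - t)) *\<^sub>R (\<phi> (Xt \<omega>) *\<^sub>R ?E \<omega>))"
      using ce(1) by (rule integrable_scaleR_right)
    then show "integrable M (\<lambda>\<omega>. \<phi> (Xt \<omega>) *\<^sub>R ?\<rho> (Xt \<omega>))"
      by (simp only: eq cong: Bochner_Integration.integrable_cong)
    have "(LINT \<omega>|M. \<phi> (Xt \<omega>) *\<^sub>R ?\<rho> (Xt \<omega>)) = (LINT \<omega>|M. - (1 / sqrt (1 - t)) *\<^sub>R (\<phi> (Xt \<omega>) *\<^sub>R ?E \<omega>))"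
      by (rule Bochner_Integration.integral_cong[OF refl eq])
    also have "\<dots> = - (1 / sqrt (1 - t)) *\<^sub>R (LINT \<omega>|M. \<phi> (Xt \<omega>) *\<^sub>R ?E \<omega>)"
      by (rule integral_scaleR_right)
    also have "\<dots> = - (LINT \<omega>|M. gradient \<phi> (Xt \<omega>))"
      using t by (simp add: ce(2) test_GZ[OF \<phi>])
    finally show "(LINT \<omega>|M. \<phi> (Xt \<omega>) *\<^sub>R ?\<rho> (Xt \<omega>)) = - (LINT \<omega>|M. gradient \<phi> (Xt \<omega>))" .
  qed measurable
  with w that[of ?\<rho>] show thesis by simp
qed

lemma ex_score_Y:
  obtains \<rho> where "is_score M Xt \<rho>"
    "\<And>\<omega>. \<omega> \<in> space M \<Longrightarrow> \<rho> (Xt \<omega>) = - (t / sqrt (1 - t)) *\<^sub>R cond_exp_vec M Xt Y \<omega> - G *v Xt \<omega>"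
proof -
  let ?E = "cond_exp_vec M Xt Y" and ?s = "t / sqrt (1 - t)"
  have Y_int: "integrable M Y" using Y_integrable by (simp add: Y_def[abs_def])
  have Xt_int: "integrable M Xt"
    unfolding Xt_def[abs_def] using X_integrable(1) Z_integrable(1) by simp
  have GXt_int: "integrable M (\<lambda>\<omega>. G *v Xt \<omega>)"
    by (rule integrable_bounded_linear[OF matrix_vector_mul_bounded_linear Xt_int])
  obtain w where [measurable]: "w \<in> borel_measurable borel" and w: "\<And>\<omega>. \<omega> \<in> space M \<Longrightarrow> ?E \<omega> = w (Xt \<omega>)"
    using cond_exp_vec_factor[OF Xt_measurable] by blast
  let ?\<rho> = "\<lambda>y. - ?s *\<^sub>R w y - G *v y"
  have "is_score M Xt ?\<rho>"
    unfolding is_score_def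
  proof (intro conjI allI impI)
    fix \<phi> :: "real^'n \<Rightarrow> real" assume \<phi>: "test_function \<phi>"
    obtain B where B: "0 < B" "\<And>x. \<bar>\<phi> x\<bar> \<le> B" "\<And>x. norm (gradient \<phi> x) \<le> B"
      using test_function_bounded[OF \<phi>] by metis
    note ce = cond_exp_vec_scaleR[OF Xt_measurable Y_int test_function_measurable(1)[OF \<phi>] B(2)]
    note int_GXt = integrable_test_scaleR[OF \<phi> GXt_int]
    have eq: "\<phi> (Xt \<omega>) *\<^sub>R ?\<rho> (Xt \<omega>) = - ?s *\<^sub>R (\<phi> (Xt \<omega>) *\<^sub>R ?E \<omega>) - \<phi> (Xt \<omega>) *\<^sub>R (G *v Xt \<omega>)"
      if "\<omega> \<in> space M" for \<omega>
      by (simp add: w[OF that] algebra_simps)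
    have int_E: "integrable M (\<lambda>\<omega>. - ?s *\<^sub>R (\<phi> (Xt \<omega>) *\<^sub>R ?E \<omega>))"
      using ce(1) by (rule integrable_scaleR_right)
    then have "integrable M (\<lambda>\<omega>. - ?s *\<^sub>R (\<phi> (Xt \<omega>) *\<^sub>R ?E \<omega>) - \<phi> (Xt \<omega>) *\<^sub>R (G *v Xt \<omega>))"
      using int_GXt by (rule Bochner_Integration.integrable_diff)
    then show "integrable M (\<lambda>\<omega>. \<phi> (Xt \<omega>) *\<^sub>R ?\<rho> (Xt \<omega>))"
      by (simp only: eq cong: Bochner_Integration.integrable_cong)
    let ?D = "LINT \<omega>|M. gradient \<phi> (Xt \<omega>)" and ?X = "LINT \<omega>|M. \<phi> (Xt \<omega>) *\<^sub>R X \<omega>"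
    have "(LINT \<omega>|M. \<phi> (Xt \<omega>) *\<^sub>R ?\<rho> (Xt \<omega>)) = (LINT \<omega>|M. - ?s *\<^sub>R (\<phi> (Xt \<omega>) *\<^sub>R ?E \<omega>) - \<phi> (Xt \<omega>) *\<^sub>R (G *v Xt \<omega>))"
      by (rule Bochner_Integration.integral_cong[OF refl eq])
    also have "\<dots> = - ?s *\<^sub>R (LINT \<omega>|M. \<phi> (Xt \<omega>) *\<^sub>R Y \<omega>) - (LINT \<omega>|M. \<phi> (Xt \<omega>) *\<^sub>R (G *v Xt \<omega>))"
      using int_E by (simp only: Bochner_Integration.integral_diff[OF _ int_GXt] integral_scaleR_right ce(2))
    also have "(LINT \<omega>|M. \<phi> (Xt \<omega>) *\<^sub>R (G *v Xt \<omega>))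
        = (LINT \<omega>|M. sqrt t *\<^sub>R (G *v (\<phi> (Xt \<omega>) *\<^sub>R X \<omega>)) + sqrt (1 - t) *\<^sub>R (\<phi> (Xt \<omega>) *\<^sub>R (G *v Z \<omega>)))"
      by (simp add: Xt_def algebra_simps matrix_vector_right_distrib matrix_vector_mult_scaleR)
    \<comment> \<open>The \<open>Z\<close> part of \<open>Xt\<close> contributes sqrt (1 - t) as its
      weight and once more through integration by parts, hence 1 - t.\<close>
    also have "\<dots> = sqrt t *\<^sub>R (G *v ?X) + (1 - t) *\<^sub>R ?D"
    proof -
      note int_X = integrable_test_scaleR[OF \<phi> X_integrable(1)]
      have "(LINT \<omega>|M. sqrt t *\<^sub>R (G *v (\<phi> (Xt \<omega>) *\<^sub>R X \<omega>)) + sqrt (1 - t) *\<^sub>R (\<phi> (Xt \<omega>) *\<^sub>R (G *v Z \<omega>)))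
          = sqrt t *\<^sub>R (G *v ?X) + sqrt (1 - t) *\<^sub>R (LINT \<omega>|M. \<phi> (Xt \<omega>) *\<^sub>R (G *v Z \<omega>))"
        by (simp only: Bochner_Integration.integral_add[OF
            integrable_scaleR_right[OF integrable_bounded_linear[OF matrix_vector_mul_bounded_linear int_X]]
            integrable_scaleR_right[OF integrable_test_scaleR[OF \<phi> GZ_integrable]]]
            integral_scaleR_right integral_bounded_linear[OF matrix_vector_mul_bounded_linear int_X])
      then show ?thesis using t by (simp add: test_GZ[OF \<phi>])
    qed
    also have "- ?s *\<^sub>R (LINT \<omega>|M. \<phi> (Xt \<omega>) *\<^sub>R Y \<omega>) = - (t *\<^sub>R ?D - sqrt t *\<^sub>R (G *v ?X))"
    proof -
      \<comment> \<open>One factor sqrt t is split off, since \<open>test_Y\<close> evaluates sqrt t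
        times the integral.\<close>
      have s: "?s = (sqrt t / sqrt (1 - t)) * sqrt t" using t by simp
      show ?thesis
        unfolding s scaleR_minus_left scaleR_scaleR[symmetric] test_Y[OF \<phi>] using t
        by (simp add: scaleR_diff_right)
    qed
    finally show "(LINT \<omega>|M. \<phi> (Xt \<omega>) *\<^sub>R ?\<rho> (Xt \<omega>)) = - ?D"
      by (simp add: algebra_simps)
  qed measurable
  with w that[of ?\<rho>] show thesis by simp
qed

end

section \<open>Second moments and the Fisher information formulas\<close>

context gaussian_smoothing
begin

lemma independent_product:
  fixes u v :: "real^'n \<Rightarrow> real"
  assumes "u \<in> borel_measurable borel" "v \<in> borel_measurable borel"
    and u: "integrable M (\<lambda>\<omega>. u (X \<omega>))" and v: "integrable M (\<lambda>\<omega>. v (Z \<omega>))"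
  shows "integrable M (\<lambda>\<omega>. u (X \<omega>) * v (Z \<omega>))"
    "(LINT \<omega>|M. u (X \<omega>) * v (Z \<omega>)) = (LINT \<omega>|M. u (X \<omega>)) * (LINT \<omega>|M. v (Z \<omega>))"
proof -
  have "indep_var borel (u \<circ> X) borel (v \<circ> Z)"
    by (rule indep_var_compose[OF indep]) fact+
  then show "integrable M (\<lambda>\<omega>. u (X \<omega>) * v (Z \<omega>))"
    "(LINT \<omega>|M. u (X \<omega>) * v (Z \<omega>)) = (LINT \<omega>|M. u (X \<omega>)) * (LINT \<omega>|M. v (Z \<omega>))"
    using indep_var_integrable[of "u \<circ> X" "v \<circ> Z"] indep_var_lebesgue_integral[of "u \<circ> X" "v \<circ> Z"] u v
    by (simp_all add: comp_def)
qed

lemma X_component: "integrable M (\<lambda>\<omega>. X \<omega> $ i)" "(LINT \<omega>|M. X \<omega> $ i) = 0"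
  using integrable_vec_nth[OF X_integrable(1)] integral_vec_nth[OF X_integrable(1), of i] by (simp_all add: X_centered)

lemma Z_component: "integrable M (\<lambda>\<omega>. Z \<omega> $ i)" "(LINT \<omega>|M. Z \<omega> $ i) = 0"
  using integrable_vec_nth[OF Z_integrable(1)] integral_vec_nth[OF Z_integrable(1), of i] by (simp_all add: Z_centered)

lemma X_Z_uncorrelated:
  "integrable M (\<lambda>\<omega>. X \<omega> $ i * Z \<omega> $ j)" "(LINT \<omega>|M. X \<omega> $ i * Z \<omega> $ j) = 0"
  using independent_product[of "\<lambda>x. x $ i" "\<lambda>z. z $ j"] X_component[of i] Z_component[of j] by auto

lemma X_GZ_uncorrelated:
  "integrable M (\<lambda>\<omega>. X \<omega> $ i * (G *v Z \<omega>) $ j)" "(LINT \<omega>|M. X \<omega> $ i * (G *v Z \<omega>) $ j) = 0"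
  using independent_product[of "\<lambda>x. x $ i" "\<lambda>z. (G *v z) $ j"] X_component[of i]
    integrable_vec_nth[OF GZ_integrable, of j] by auto

lemma Xt_centered: "integral\<^sup>L M Xt = 0"
  unfolding Xt_def[abs_def] using X_integrable(1) Z_integrable(1) X_centered Z_centered by simp

text \<open>Both summands have covariance \<open>C\<close> and their weights t and 1 - t add up to
  one; the cross terms vanish by independence and centering.\<close>

lemma Xt_second_moment:
  "integrable M (\<lambda>\<omega>. Xt \<omega> $ i * Xt \<omega> $ j)" "(LINT \<omega>|M. Xt \<omega> $ i * Xt \<omega> $ j) = C $ i $ j"
proof -
  let ?st = "sqrt t" and ?s1 = "sqrt (1 - t)"
  have sq: "?st * ?st = t" "?s1 * ?s1 = 1 - t" using t by auto
  have "Xt \<omega> $ i * Xt \<omega> $ j = (?st * ?st) * (X \<omega> $ i * X \<omega> $ j) + (?s1 * ?s1) * (Z \<omega> $ i * Z \<omega> $ j)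
      + (?st * ?s1) * (X \<omega> $ i * Z \<omega> $ j) + (?st * ?s1) * (X \<omega> $ j * Z \<omega> $ i)" for \<omega>
    by (simp add: Xt_def algebra_simps)
  then have eq: "Xt \<omega> $ i * Xt \<omega> $ j = t * (X \<omega> $ i * X \<omega> $ j) + (1 - t) * (Z \<omega> $ i * Z \<omega> $ j)
      + (?st * ?s1) * (X \<omega> $ i * Z \<omega> $ j) + (?st * ?s1) * (X \<omega> $ j * Z \<omega> $ i)" for \<omega>
    unfolding sq .
  show "integrable M (\<lambda>\<omega>. Xt \<omega> $ i * Xt \<omega> $ j)"
    unfolding eq by (intro Bochner_Integration.integrable_add integrable_mult_right X_integrable Z_integrable X_Z_uncorrelated)
  have XX: "(LINT \<omega>|M. X \<omega> $ i * X \<omega> $ j) = C $ i $ j"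
    using covariance_matrix_centered[OF X_centered X_integrable(2)] by (simp add: C_eq)
  show "(LINT \<omega>|M. Xt \<omega> $ i * Xt \<omega> $ j) = C $ i $ j"
    unfolding eq using X_integrable(2) Z_integrable(2) X_Z_uncorrelated
    by (simp add: XX Z_second_moment left_diff_distrib)
qed

lemma covariance_Xt: "covariance_matrix M Xt = C"
  by (simp add: vec_eq_iff covariance_matrix_centered[OF Xt_centered Xt_second_moment(1)] Xt_second_moment(2))

lemma GXt_second_moment:
  "integrable M (\<lambda>\<omega>. (G *v Xt \<omega>) $ i * (G *v Xt \<omega>) $ j)"
  "(LINT \<omega>|M. (G *v Xt \<omega>) $ i * (G *v Xt \<omega>) $ j) = G $ i $ j"
proof -
  \<comment> \<open>A row of the symmetric matrix \<open>G\<close> is \<open>G\<close> applied to a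
    basis vector, so \<open>C\<close> cancels one factor of G C G.\<close>
  have row: "G $ j = G *v axis j 1"
    using symmetric by (simp add: vec_eq_iff matrix_vector_mul_component inner_axis transpose_def)
  note bil = covariance_matrix_bilinear[OF Xt_centered Xt_second_moment(1), of "G $ i" "G $ j"]
  show "integrable M (\<lambda>\<omega>. (G *v Xt \<omega>) $ i * (G *v Xt \<omega>) $ j)"
    using bil(1) by (simp add: matrix_vector_mul_component)
  show "(LINT \<omega>|M. (G *v Xt \<omega>) $ i * (G *v Xt \<omega>) $ j) = G $ i $ j"
    using bil(2) by (simp add: matrix_vector_mul_component covariance_Xt row C_G inner_axis)
qed

text \<open>By uniqueness an arbitrary score may be replaced by the multiple of E[G Z | Xt]. The
  pairing with a coordinate of \<open>Xt\<close> is computed through the conditional expectation,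
  because a coordinate is not a test function and the defining identity of a score does not apply to
  it.\<close>

lemma score_moments:
  assumes \<rho>: "is_score M Xt \<rho>"
  shows "integrable M (\<lambda>\<omega>. \<rho> (Xt \<omega>) $ i * \<rho> (Xt \<omega>) $ j)"
    and "integrable M (\<lambda>\<omega>. \<rho> (Xt \<omega>) $ i * (G *v Xt \<omega>) $ j)"
    and "(LINT \<omega>|M. \<rho> (Xt \<omega>) $ i * (G *v Xt \<omega>) $ j) = - G $ i $ j"
proof -
  let ?E = "cond_exp_vec M Xt (\<lambda>\<omega>. G *v Z \<omega>)" and ?s = "1 / sqrt (1 - t)"
  have [measurable]: "\<rho> \<in> borel_measurable borel" using \<rho> by (simp add: is_score_def)
  obtain \<rho>' where "is_score M Xt \<rho>'" and \<rho>': "\<And>\<omega>. \<omega> \<in> space M \<Longrightarrow> \<rho>' (Xt \<omega>) = - ?s *\<^sub>R ?E \<omega>"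
    using ex_score_GZ by blast
  then have "AE \<omega> in M. \<rho> (Xt \<omega>) = \<rho>' (Xt \<omega>)"
    using score_unique[OF Xt_measurable \<rho>] by blast
  with AE_space have AE: "AE \<omega> in M. \<rho> (Xt \<omega>) = - ?s *\<^sub>R ?E \<omega>"
    by eventually_elim (simp only: \<rho>')
  have [measurable]: "(\<lambda>\<omega>. ?E \<omega> $ i) \<in> borel_measurable M" for i
    by (simp add: cond_exp_vec_def)
  have GZ_sq: "integrable M (\<lambda>\<omega>. ((G *v Z \<omega>) $ i)\<^sup>2)" for i
    using covariance_matrix_bilinear(1)[OF Z_centered Z_integrable(2), of "G $ i" "G $ i"]
    by (simp add: matrix_vector_mul_component power2_eq_square)
  have E_sq: "integrable M (\<lambda>\<omega>. (?E \<omega> $ i)\<^sup>2)" for i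
    by (rule cond_exp_vec_square_integrable[OF Xt_measurable integrable_vec_nth[OF GZ_integrable] GZ_sq])
  have \<rho>_sq: "integrable M (\<lambda>\<omega>. (\<rho> (Xt \<omega>) $ i)\<^sup>2)" for i
  proof (rule integrable_cong_AE_imp[OF integrable_mult_right[OF E_sq[of i], of "?s\<^sup>2"]])
    show "AE \<omega> in M. ?s\<^sup>2 * (?E \<omega> $ i)\<^sup>2 = (\<rho> (Xt \<omega>) $ i)\<^sup>2"
      using AE by eventually_elim (simp add: power_mult_distrib power_divide)
  qed measurable
  show "integrable M (\<lambda>\<omega>. \<rho> (Xt \<omega>) $ i * \<rho> (Xt \<omega>) $ j)"
    by (rule integrable_product_of_square_integrable[OF _ _ \<rho>_sq \<rho>_sq]) measurable
  have \<rho>_Xt: "integrable M (\<lambda>\<omega>. \<rho> (Xt \<omega>) $ i * Xt \<omega> $ k)"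
    "(LINT \<omega>|M. \<rho> (Xt \<omega>) $ i * Xt \<omega> $ k) = - (if i = k then 1 else 0)" for k
  proof -
    \<comment> \<open>Only the \<open>Z\<close> part of \<open>Xt\<close> correlates with
      \<open>G Z\<close>, and its weight sqrt (1 - t) cancels the normalisation of the
      score.\<close>
    have eq: "Xt \<omega> $ k * (G *v Z \<omega>) $ i = sqrt t * (X \<omega> $ k * (G *v Z \<omega>) $ i) + sqrt (1 - t) * (Z \<omega> $ k * (G *v Z \<omega>) $ i)" for \<omega>
      by (simp add: Xt_def algebra_simps)
    have int: "integrable M (\<lambda>\<omega>. Xt \<omega> $ k * (G *v Z \<omega>) $ i)"
      unfolding eq by (intro Bochner_Integration.integrable_add integrable_mult_right X_GZ_uncorrelated GZ_Z)
    have val: "(LINT \<omega>|M. Xt \<omega> $ k * (G *v Z \<omega>) $ i) = sqrt (1 - t) * (if i = k then 1 else 0)"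
      unfolding eq using X_GZ_uncorrelated[of k i] GZ_Z[of k i] by simp
    have meas: "(\<lambda>\<omega>. G *v Z \<omega>) \<in> borel_measurable M" by measurable
    have meas': "(\<lambda>y. y $ k) \<in> borel_measurable (borel :: (real^'n) measure)" by measurable
    note ce = cond_exp_vec_mult[OF Xt_measurable meas meas' int]
    have AE': "AE \<omega> in M. - ?s * (Xt \<omega> $ k * ?E \<omega> $ i) = \<rho> (Xt \<omega>) $ i * Xt \<omega> $ k"
      using AE by eventually_elim simp
    show "integrable M (\<lambda>\<omega>. \<rho> (Xt \<omega>) $ i * Xt \<omega> $ k)"
      by (rule integrable_cong_AE_imp[OF integrable_mult_right[OF ce(1)] _ AE']) measurable
    have "(LINT \<omega>|M. \<rho> (Xt \<omega>) $ i * Xt \<omega> $ k) = (LINT \<omega>|M. - ?s * (Xt \<omega> $ k * ?E \<omega> $ i))"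
      using AE' by (intro integral_cong_AE) auto
    also have "\<dots> = - ?s * (LINT \<omega>|M. Xt \<omega> $ k * ?E \<omega> $ i)"
      by (rule integral_mult_right_zero)
    also have "\<dots> = - (if i = k then 1 else 0)"
      unfolding ce(2) val using t by simp
    finally show "(LINT \<omega>|M. \<rho> (Xt \<omega>) $ i * Xt \<omega> $ k) = - (if i = k then 1 else 0)" .
  qed
  have eq: "\<rho> (Xt \<omega>) $ i * (G *v Xt \<omega>) $ j = (\<Sum>k\<in>UNIV. G $ j $ k * (\<rho> (Xt \<omega>) $ i * Xt \<omega> $ k))" for \<omega>
    by (simp add: matrix_vector_mult_def sum_distrib_left mult_ac)
  show "integrable M (\<lambda>\<omega>. \<rho> (Xt \<omega>) $ i * (G *v Xt \<omega>) $ j)"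
    unfolding eq by (intro Bochner_Integration.integrable_sum integrable_mult_right \<rho>_Xt)
  have "(LINT \<omega>|M. \<rho> (Xt \<omega>) $ i * (G *v Xt \<omega>) $ j) = (\<Sum>k\<in>UNIV. G $ j $ k * (- (if i = k then 1 else 0)))"
    unfolding eq using \<rho>_Xt by (subst Bochner_Integration.integral_sum) auto
  also have "\<dots> = (\<Sum>k\<in>UNIV. if i = k then - G $ j $ k else 0)"
    by (intro sum.cong) auto
  also have "\<dots> = - G $ i $ j"
    using symmetric by (simp add: vec_eq_iff transpose_def)
  finally show "(LINT \<omega>|M. \<rho> (Xt \<omega>) $ i * (G *v Xt \<omega>) $ j) = - G $ i $ j" .
qed

lemma fisher_information_representation:
  fixes W defines "W \<equiv> cond_exp_vec M Xt Y"
  assumes \<rho>: "is_score M Xt \<rho>"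
  shows "integrable M (\<lambda>\<omega>. outer (W \<omega>) (W \<omega>))"
    and "integrable M (\<lambda>\<omega>. outer (\<rho> (Xt \<omega>)) (\<rho> (Xt \<omega>)))"
    and "fisher_information M Xt \<rho> = (t\<^sup>2 / (1 - t)) *\<^sub>R (LINT \<omega>|M. outer (W \<omega>) (W \<omega>)) + G"
    and "standardised_fisher_distance M Xt \<rho> = t\<^sup>2 / (1 - t) * trace (C ** (LINT \<omega>|M. outer (W \<omega>) (W \<omega>)))"
proof -
  let ?s = "t / sqrt (1 - t)" and ?s2 = "t\<^sup>2 / (1 - t)"
  let ?\<rho> = "\<lambda>\<omega>. \<rho> (Xt \<omega>)" and ?V = "\<lambda>\<omega>. G *v Xt \<omega>"
  have [measurable]: "\<rho> \<in> borel_measurable borel" using \<rho> by (simp add: is_score_def)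
  have [measurable]: "(\<lambda>\<omega>. W \<omega> $ i) \<in> borel_measurable M" for i
    by (simp add: W_def cond_exp_vec_def)
  note mom = score_moments[OF \<rho>] GXt_second_moment
  obtain \<rho>' where "is_score M Xt \<rho>'" and \<rho>': "\<And>\<omega>. \<omega> \<in> space M \<Longrightarrow> \<rho>' (Xt \<omega>) = - ?s *\<^sub>R W \<omega> - G *v Xt \<omega>"
    using ex_score_Y unfolding W_def by blast
  then have "AE \<omega> in M. ?\<rho> \<omega> = \<rho>' (Xt \<omega>)"
    using score_unique[OF Xt_measurable \<rho>] by blast
  with AE_space have "AE \<omega> in M. ?\<rho> \<omega> = - ?s *\<^sub>R W \<omega> - ?V \<omega>"
    by eventually_elim (simp only: \<rho>')
  then have AE: "AE \<omega> in M. (?\<rho> \<omega> + ?V \<omega>) $ i * (?\<rho> \<omega> + ?V \<omega>) $ j = ?s2 * (W \<omega> $ i * W \<omega> $ j)" for i j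
  proof eventually_elim
    case (elim \<omega>)
    have "?s * ?s = ?s2" using t by (simp add: power2_eq_square)
    moreover have "(?\<rho> \<omega> + ?V \<omega>) $ i * (?\<rho> \<omega> + ?V \<omega>) $ j = (?s * ?s) * (W \<omega> $ i * W \<omega> $ j)"
      by (simp add: elim)
    ultimately show ?case by simp
  qed
  have expand: "(?\<rho> \<omega> + ?V \<omega>) $ i * (?\<rho> \<omega> + ?V \<omega>) $ j
      = ?\<rho> \<omega> $ i * ?\<rho> \<omega> $ j + ?\<rho> \<omega> $ i * ?V \<omega> $ j + ?\<rho> \<omega> $ j * ?V \<omega> $ i + ?V \<omega> $ i * ?V \<omega> $ j" for \<omega> i j
    by (simp add: algebra_simps)
  have rel_int: "integrable M (\<lambda>\<omega>. (?\<rho> \<omega> + ?V \<omega>) $ i * (?\<rho> \<omega> + ?V \<omega>) $ j)" for i j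
    unfolding expand by (intro Bochner_Integration.integrable_add mom)
  \<comment> \<open>The two mixed terms contribute - G each and the last square contributes G,
    leaving the Fisher information minus G.\<close>
  have rel: "(LINT \<omega>|M. (?\<rho> \<omega> + ?V \<omega>) $ i * (?\<rho> \<omega> + ?V \<omega>) $ j) = (LINT \<omega>|M. ?\<rho> \<omega> $ i * ?\<rho> \<omega> $ j) - G $ i $ j" for i j
  proof -
    have "G $ j $ i = G $ i $ j" using symmetric by (simp add: vec_eq_iff transpose_def)
    then show ?thesis unfolding expand using mom by simp
  qed
  \<comment> \<open>The relation is read backwards: \<open>?s2\<close> is nonzero because t > 0, so
    products of components of \<open>W\<close> inherit integrability from those of
    \<open>?\<rho> + ?V\<close>.\<close>
  have W_int: "integrable M (\<lambda>\<omega>. W \<omega> $ i * W \<omega> $ j)" for i j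
  proof (rule integrable_cong_AE_imp[OF integrable_mult_right[OF rel_int[of i j], of "1 / ?s2"]])
    show "AE \<omega> in M. 1 / ?s2 * ((?\<rho> \<omega> + ?V \<omega>) $ i * (?\<rho> \<omega> + ?V \<omega>) $ j) = W \<omega> $ i * W \<omega> $ j"
      using AE[of i j] by eventually_elim (use t in \<open>simp only:, simp\<close>)
  qed measurable
  have rel_W: "(LINT \<omega>|M. (?\<rho> \<omega> + ?V \<omega>) $ i * (?\<rho> \<omega> + ?V \<omega>) $ j) = ?s2 * (LINT \<omega>|M. W \<omega> $ i * W \<omega> $ j)" for i j
  proof -
    have "(LINT \<omega>|M. (?\<rho> \<omega> + ?V \<omega>) $ i * (?\<rho> \<omega> + ?V \<omega>) $ j) = (LINT \<omega>|M. ?s2 * (W \<omega> $ i * W \<omega> $ j))"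
      by (intro integral_cong_AE AE) measurable
    then show ?thesis by (simp only: integral_mult_right_zero)
  qed
  show "integrable M (\<lambda>\<omega>. outer (W \<omega>) (W \<omega>))"
    by (rule integrable_outer[OF W_int])
  show "integrable M (\<lambda>\<omega>. outer (?\<rho> \<omega>) (?\<rho> \<omega>))"
    by (rule integrable_outer[OF mom(1)])
  show "fisher_information M Xt \<rho> = ?s2 *\<^sub>R (LINT \<omega>|M. outer (W \<omega>) (W \<omega>)) + G"
    unfolding fisher_information_def vec_eq_iff
  proof (intro allI)
    fix i j
    have "(LINT \<omega>|M. ?\<rho> \<omega> $ i * ?\<rho> \<omega> $ j) = ?s2 * (LINT \<omega>|M. W \<omega> $ i * W \<omega> $ j) + G $ i $ j"
      using rel[of i j] rel_W[of i j] by linarith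
    then show "(LINT \<omega>|M. outer (?\<rho> \<omega>) (?\<rho> \<omega>)) $ i $ j = (?s2 *\<^sub>R (LINT \<omega>|M. outer (W \<omega>) (W \<omega>)) + G) $ i $ j"
      by (simp only: integral_outer[OF mom(1)] vector_add_component vector_scaleR_component integral_outer[OF W_int] real_scaleR_def)
  qed
  \<comment> \<open>As \<open>Xt\<close> has covariance \<open>C\<close>, the inverse covariance in
    the definition is \<open>G\<close>, and the integrand is the square already evaluated.\<close>
  have "relative_fisher_information M Xt \<rho> = ?s2 *\<^sub>R (LINT \<omega>|M. outer (W \<omega>) (W \<omega>))"
    unfolding relative_fisher_information_def covariance_Xt vec_eq_iff
    by (simp only: integral_outer[OF rel_int] rel_W vector_scaleR_component integral_outer[OF W_int] real_scaleR_def) simp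
  then show "standardised_fisher_distance M Xt \<rho> = ?s2 * trace (C ** (LINT \<omega>|M. outer (W \<omega>) (W \<omega>)))"
    by (simp add: standardised_fisher_distance_def covariance_Xt matrix_scalar_ac trace_def sum_distrib_left flip: scalar_matrix_assoc)
qed

end

text \<open>The existence clause keeps the statement about all scores from being vacuous. The
  integrability clauses ensure that the matrices in the formulas are genuine expectations, since a
  non-integrable function would have integral 0.\<close>

theorem mainTheorem2:
  fixes M :: "'a measure"
    and X Z Xt Y W :: "'a \<Rightarrow> real^'n"
    and C :: "real^'n^'n"
    and \<tau> :: "real^'n \<Rightarrow> real^'n^'n"
    and t :: real
  assumes "prob_space M"
    and X_density: "\<exists>f. distributed M lborel X f"
    and X_square_integrable: "integrable M (\<lambda>\<omega>. (norm (X \<omega>))\<^sup>2)"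
    and X_centered: "integral\<^sup>L M X = 0"
    and C_eq: "C = covariance_matrix M X"
    and C_invertible: "invertible C"
    and stein: "is_stein_matrix M X \<tau>"
    and Z_gaussian: "centered_gaussian M C Z"
    and indep: "prob_space.indep_var M borel X borel Z"
    and t: "0 < t" "t < 1"
    and Xt_eq: "Xt = (\<lambda>\<omega>. sqrt t *\<^sub>R X \<omega> + sqrt (1 - t) *\<^sub>R Z \<omega>)"
    and Y_eq: "Y = (\<lambda>\<omega>. (mat 1 - matrix_inv C ** \<tau> (X \<omega>)) *v (matrix_inv C *v Z \<omega>))"
    and Y_integrable: "integrable M Y"
    and W_eq: "W = cond_exp_vec M Xt Y"
  shows "(\<exists>\<rho>. is_score M Xt \<rho>) \<and>
    integrable M (\<lambda>\<omega>. outer (W \<omega>) (W \<omega>)) \<and>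
    (\<forall>\<rho>. is_score M Xt \<rho> \<longrightarrow>
       integrable M (\<lambda>\<omega>. outer (\<rho> (Xt \<omega>)) (\<rho> (Xt \<omega>))) \<and>
       fisher_information M Xt \<rho> =
         (t\<^sup>2 / (1 - t)) *\<^sub>R (LINT \<omega>|M. outer (W \<omega>) (W \<omega>)) + matrix_inv C \<and>
       standardised_fisher_distance M Xt \<rho> =
         t\<^sup>2 / (1 - t) * trace (C ** (LINT \<omega>|M. outer (W \<omega>) (W \<omega>))))"
proof -
  interpret prob_space M by fact
  obtain f where "distributed M lborel X f" using X_density by blast
  then have X_meas: "X \<in> borel_measurable M" using distributed_measurable by fastforce
  note X_moments = square_integrable_components[OF X_meas X_square_integrable]
  obtain c K where "gaussian_vector M C c K Z"
    using gaussian_vector_covariance[OF X_centered X_moments(1)] C_invertible Z_gaussian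
    unfolding C_eq by blast
  then interpret gaussian_vector M C c K Z .
  interpret S: gaussian_smoothing M C c K Z X \<tau> t
    using X_meas X_square_integrable X_centered C_eq stein indep t Y_integrable
    unfolding Y_eq by unfold_locales
  have Xt: "Xt = S.Xt" and W: "W = cond_exp_vec M S.Xt S.Y"
    by (simp_all add: W_eq Xt_eq Y_eq S.Xt_def[abs_def] S.Y_def[abs_def])
  obtain \<rho> where "is_score M S.Xt \<rho>" using S.ex_score_Y by blast
  then show ?thesis
    unfolding Xt W using S.fisher_information_representation by blast
qed

end
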